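(* Let $\Omega\subseteq S^2$ with $|\partial\Omega|=0$, let $f\in L^1(\bar\Omega)$ with $f>0$ a.e., let $g_1,\dots,g_N>0$ with $N>1$, let $D=\{P_1,\dots,P_N\}\subset\mathbb{R}^3$ be a set of $N$ distinct points with $O\notin D$, $M=\max_i OP_i$, and $\eta=\sum_{i=1}^N g_i\delta_{P_i}$. Let $\delta>0$, $c_\delta=-\delta+\sqrt{1+\delta^2}$, $k\ge\frac{1+c_\delta}{1-c_\delta}$, and suppose $\int_{\bar\Omega}f\,dx\ge\frac{1}{C}\,\eta(D)$ with $C=\frac{(1-c_\delta)^3}{(1+c_\delta)(k\delta M)^2}$. Let $$\mathcal C=\{w=(d_1,\dots,d_N):\ d_1=k\delta M,\ d_i\ge\delta M,\ \mu_w(P_i)=g_i\ \text{for }2\le i\le N\},$$ $$\mathcal D=\{w=(d_1,\dots,d_N):\ d_i\ge\delta M\ \text{for all }i,\ \mu_w(P_1)\ge g_1,\ \mu_w(P_i)=g_i\ \text{for }2\le i\le N\}.$$ Then: (1) there exists $w_{\mathcal C}\in\mathcal C$ such that $\mu_{w_{\mathcal C}}(P_1)\le\mu_w(P_1)$ for all $w\in\mathcal C$; (2) there exists $w_{\mathcal D}\in\mathcal D$ such that $\mu_{w_{\mathcal D}}(P_1)\le\mu_w(P_1)$ for all $w\in\mathcal D$.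
   Context: $S^2$ is the unit sphere of $\mathbb{R}^3$ centered at the origin $O$; $dx$ and $|\cdot|$ denote surface (Lebesgue) measure on $S^2$; $\bar\Omega$, $\partial\Omega$ are closure and boundary in $S^2$. For $P\ne O$ write $OP=|P|$ and $m_P=P/|P|$. For $d>0$, $E_d(P)$ is the ellipsoid of revolution with foci $O$ and $P$ with polar radius $\rho_d(x)=\frac{d}{1-\varepsilon\,x\cdot m_P}$, $x\in S^2$, where $\varepsilon=\sqrt{1+\frac{d^2}{OP^2}}-\frac{d}{OP}\in(0,1)$ is its eccentricity ($\rho_d$ also depends on $P$). For $w=(d_1,\dots,d_N)$ with $d_i>0$, $\rho_w(x)=\min_{1\le i\le N}\rho_{d_i}(x)$, where $\rho_{d_i}$ is the polar radius of $E_{d_i}(P_i)$; the associated reflector is $\sigma_w=\{\rho_w(x)x\}_{x\in\bar\Omega}$. For $P\in D$, $\tau_{\sigma_w}(P)$ is the set of $x_0\in\bar\Omega$ such that some ellipsoid $E_d(P)$ supports $\sigma_w$ at $\rho_w(x_0)x_0$, i.e. $\rho_w\le\rho_d$ on $\bar\Omega$ with equality at $x_0$; $\tau_{\sigma_w}(E)=\bigcup_{P\in E}\tau_{\sigma_w}(P)$. The reflector measure of $w$ is $$\mu_w(E)=\int_{\tau_{\sigma_w}(E)}f(x)\,\frac{x\cdot\nu_w(x)}{\rho_w(x)^2}\,dx,\qquad E\subseteq D,$$ where $\nu_w(x)$ is the outer unit normal to $\sigma_w$ at $\rho_w(x)x$ (defined for a.e. $x$; a.e. it equals $\frac{x-\varepsilon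 m_P}{|x-\varepsilon m_P|}$ with $E_d(P)$ the supporting ellipsoid at that point and $\varepsilon$ its eccentricity). $\mu_w(P_i)$ means $\mu_w(\{P_i\})$. *)

theory Defs
  imports "HOL-Analysis.Analysis"
begin

abbreviation S2 :: "(real^3) set" where
  "S2 \<equiv> sphere 0 1"

text \<open>
  The measure of a Borel subset of the sphere is three times the volume of the cone over it
  in the unit ball, by integration in polar coordinates; the completion makes the
  measurable sets the Lebesgue measurable ones.
\<close>

definition surface_measure :: "(real^3) measure" where
  "surface_measure =
     completion (scale_measure 3
       (distr (restrict_space lborel (ball 0 1 - {0})) (restrict_space borel S2) sgn))"

lemma space_surface_measure: "space surface_measure = S2"
  by (simp add: surface_measure_def space_restrict_space space_scale_measure)

lemma emeasure_surface_measure_S2: "emeasure surface_measure S2 = ennreal (4 * pi)"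
proof -
  let ?B = "ball (0::real^3) 1 - {0}"
  let ?M = "restrict_space lborel ?B"
  have B: "?B \<in> sets lborel" by simp
  have sgn: "sgn \<in> measurable ?M (restrict_space borel S2)"
  proof (rule measurable_restrict_space2)
    show "sgn \<in> space ?M \<rightarrow> S2"
      by (auto simp: space_restrict_space norm_sgn)
    have "(\<lambda>x::real^3. sgn x) \<in> borel_measurable borel"
      unfolding sgn_div_norm by measurable
    then show "sgn \<in> measurable ?M borel"
      by (intro measurable_restrict_space1) simp
  qed
  have vol: "emeasure lborel ?B = ennreal (4 / 3 * pi)"
  proof -
    have "emeasure lborel ?B = emeasure lborel (ball (0::real^3) 1)"
      by (rule emeasure_Diff_null_set) (simp_all add: null_sets_def)
    also have "\<dots> = ennreal (4 / 3 * pi)"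
      by (simp add: emeasure_ball unit_ball_vol_3)
    finally show ?thesis .
  qed
  have space: "space ?M = ?B" by (simp add: space_restrict_space)
  have S: "S2 \<in> sets (restrict_space borel S2)"
    by (simp add: sets_restrict_space_iff)
  have "emeasure (distr ?M (restrict_space borel S2) sgn) S2 = emeasure ?M (space ?M)"
    using sgn S by (subst emeasure_distr)
      (auto intro!: arg_cong[where f = "emeasure ?M"] simp: space_restrict_space norm_sgn)
  also have "\<dots> = emeasure lborel ?B"
    unfolding space using B by (subst emeasure_restrict_space) auto
  finally have "emeasure (distr ?M (restrict_space borel S2) sgn) S2 = ennreal (4 / 3 * pi)"
    using vol by simp
  moreover have "3 * ennreal (4 / 3 * pi) = ennreal (4 * pi)"
    by (simp flip: ennreal_mult' ennreal_numeral)
  ultimately show ?thesis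
    unfolding surface_measure_def using S
    by (subst emeasure_completion) simp_all
qed

definition eccentricity :: "real^3 \<Rightarrow> real \<Rightarrow> real" where
  "eccentricity P d = sqrt (1 + d\<^sup>2 / (norm P)\<^sup>2) - d / norm P"

text \<open>The polar radius of the ellipsoid with foci 0 and P; here \<open>sgn P\<close> is \<open>P / |P|\<close>.\<close>

definition polar_radius :: "real^3 \<Rightarrow> real \<Rightarrow> real^3 \<Rightarrow> real" where
  "polar_radius P d x = d / (1 - eccentricity P d * (x \<bullet> sgn P))"

definition refl_radius :: "nat \<Rightarrow> (nat \<Rightarrow> real^3) \<Rightarrow> (nat \<Rightarrow> real) \<Rightarrow> real^3 \<Rightarrow> real" where
  "refl_radius N P w x = Min ((\<lambda>i. polar_radius (P i) (w i) x) ` {1..N})"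

text \<open>
  In the following definitions \<open>\<Omega>\<close> is a subset of the sphere, so that \<open>closure \<Omega>\<close> is
  also its closure in the sphere, and a surface is given by its polar radius
  \<open>\<rho>\<close> over \<open>closure \<Omega>\<close>.
\<close>

definition polar_surface :: "(real^3) set \<Rightarrow> (real^3 \<Rightarrow> real) \<Rightarrow> (real^3) set" where
  "polar_surface \<Omega> \<rho> = (\<lambda>x. \<rho> x *\<^sub>R x) ` closure \<Omega>"

definition supports_at ::
    "(real^3) set \<Rightarrow> (real^3 \<Rightarrow> real) \<Rightarrow> real^3 \<Rightarrow> real \<Rightarrow> real^3 \<Rightarrow> bool" where
  "supports_at \<Omega> \<rho> P d x\<^sub>0 \<longleftrightarrow>
     (\<forall>x \<in> closure \<Omega>. \<rho> x \<le> polar_radius P d x) \<and> \<rho> x\<^sub>0 = polar_radius P d x\<^sub>0"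

definition tracing :: "(real^3) set \<Rightarrow> (real^3 \<Rightarrow> real) \<Rightarrow> real^3 \<Rightarrow> (real^3) set" where
  "tracing \<Omega> \<rho> P = {x\<^sub>0 \<in> closure \<Omega>. \<exists>d>0. supports_at \<Omega> \<rho> P d x\<^sub>0}"

text \<open>
  A unit vector is normal to a surface at p if the directions of the secants from p become
  orthogonal to it in the limit. All surfaces here are radial graphs about the origin, so
  the outer one of the two unit normals has positive inner product with p. Where the
  surface has no tangent plane (a null set for reflectors) the value is unspecified.
\<close>

definition outer_normal :: "(real^3) set \<Rightarrow> real^3 \<Rightarrow> real^3" where
  "outer_normal S p =
     (THE n. norm n = 1 \<and> n \<bullet> p > 0 \<and>
        ((\<lambda>y. (y - p) \<bullet> n / norm (y - p)) \<longlongrightarrow> 0) (at p within S))"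

definition reflector_measure ::
    "(real^3) set \<Rightarrow> (real^3 \<Rightarrow> real) \<Rightarrow> nat \<Rightarrow> (nat \<Rightarrow> real^3) \<Rightarrow> (nat \<Rightarrow> real)
      \<Rightarrow> (real^3) set \<Rightarrow> real" where
  "reflector_measure \<Omega> f N P w E =
     (let \<rho> = refl_radius N P w;
          \<nu> = (\<lambda>x. outer_normal (polar_surface \<Omega> \<rho>) (\<rho> x *\<^sub>R x))
      in set_lebesgue_integral surface_measure (\<Union>Q\<in>E. tracing \<Omega> \<rho> Q)
           (\<lambda>x. f x * ((x \<bullet> \<nu> x) / (\<rho> x)\<^sup>2)))"

text \<open>The discrete measure with mass \<open>g i\<close> at \<open>P i\<close>, as a set function.\<close>

definition target_measure ::
    "nat \<Rightarrow> (nat \<Rightarrow> real^3) \<Rightarrow> (nat \<Rightarrow> real) \<Rightarrow> (real^3) set \<Rightarrow> real" where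
  "target_measure N P g E = (\<Sum>i=1..N. g i * indicator E (P i))"

end

theory Submission
  imports Defs
begin

text \<open>
  Two ellipsoids with different second foci agree only over a plane section of the sphere, because
  the reciprocal of the polar radius is affine in the direction. So up to null sets the tracing set
  of \<open>P i\<close> is the set where the \<open>i\<close>-th ellipsoid attains the minimum, and there the normal is that
  of the ellipsoid. By dominated convergence the reflector measures are continuous in \<open>w\<close>. The
  ellipsoids of positive measure are all visible, which bounds the ratios of their parameters by
  \<open>(1 + c) / (1 - c)\<close>; hence both sets of admissible parameters are compact. They are nonempty: minimise the
  sum of the parameters, the first being fixed, under the constraint that the measures at
  \<open>P 2, \<dots>, P N\<close> do not exceed their targets. At a minimiser all these constraints are
  tight, since lowering one parameter only lowers the other measures; and the lower bound on the
  total measure keeps the parameters away from \<open>\<delta> M\<close> and makes the measure at \<open>P 1\<close> at least \<open>g 1\<close>.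
\<close>

subsection \<open>Ellipsoids in polar coordinates\<close>

lemma eccentricity_alt: "eccentricity P d = sqrt (1 + (d / norm P)\<^sup>2) - d / norm P"
  by (simp add: eccentricity_def power_divide)

text \<open>The function \<open>sqrt (1 + t\<^sup>2)\<close> has slope at most 1. The eccentricity
  is therefore a decreasing function of \<open>d / norm P\<close>, and a lower bound on parameters
  turns into an upper bound on eccentricities.\<close>

lemma sqrt_minus_antimono:
  assumes "0 \<le> s" "s \<le> (t::real)"
  shows "sqrt (1 + t\<^sup>2) - t \<le> sqrt (1 + s\<^sup>2) - s"
proof -
  have "s \<le> sqrt (1 + s\<^sup>2)" by (rule real_le_rsqrt) simp
  then have "s * (t - s) \<le> sqrt (1 + s\<^sup>2) * (t - s)"
    using assms by (intro mult_right_mono) auto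
  moreover have "(sqrt (1 + s\<^sup>2) + (t - s))\<^sup>2 = 1 + s\<^sup>2 + (t - s)\<^sup>2 + 2 * (sqrt (1 + s\<^sup>2) * (t - s))"
    by (simp add: power2_sum)
  ultimately have "1 + t\<^sup>2 \<le> (sqrt (1 + s\<^sup>2) + (t - s))\<^sup>2"
    by (simp add: power2_eq_square algebra_simps)
  then have "sqrt (1 + t\<^sup>2) \<le> sqrt (1 + s\<^sup>2) + (t - s)"
    using assms by (intro real_le_lsqrt) auto
  then show ?thesis by simp
qed

lemma sqrt_minus_bounds:
  assumes "0 < (t::real)"
  shows "0 < sqrt (1 + t\<^sup>2) - t" "sqrt (1 + t\<^sup>2) - t < 1"
proof -
  show "0 < sqrt (1 + t\<^sup>2) - t" by (simp add: real_less_rsqrt)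
  have "sqrt (1 + t\<^sup>2) < 1 + t"
    using assms by (intro real_less_lsqrt) (auto simp: power2_sum)
  then show "sqrt (1 + t\<^sup>2) - t < 1" by simp
qed

lemma eccentricity_bounds:
  assumes "P \<noteq> 0" "0 < d"
  shows "0 < eccentricity P d" "eccentricity P d < 1"
  using sqrt_minus_bounds[of "d / norm P"] assms by (simp_all add: eccentricity_alt)

lemma inner_sgn_bound:
  fixes x P :: "real^3"
  assumes "norm x = 1"
  shows "\<bar>x \<bullet> sgn P\<bar> \<le> 1"
proof -
  have "\<bar>x \<bullet> sgn P\<bar> \<le> norm x * norm (sgn P)" by (rule Cauchy_Schwarz_ineq2)
  also have "\<dots> \<le> 1" using assms by (simp add: norm_sgn)
  finally show ?thesis .
qed

lemma polar_denominator_bounds: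
  assumes "P \<noteq> 0" "0 < d" "norm x = 1" "eccentricity P d \<le> c"
  shows "1 - c \<le> 1 - eccentricity P d * (x \<bullet> sgn P)"
    "1 - eccentricity P d * (x \<bullet> sgn P) \<le> 1 + c"
    "0 < 1 - eccentricity P d * (x \<bullet> sgn P)"
proof -
  have "\<bar>eccentricity P d * (x \<bullet> sgn P)\<bar> \<le> eccentricity P d * 1"
    using inner_sgn_bound[OF assms(3), of P] eccentricity_bounds[OF assms(1,2)]
    unfolding abs_mult by (intro mult_mono) auto
  then show "1 - c \<le> 1 - eccentricity P d * (x \<bullet> sgn P)"
    "1 - eccentricity P d * (x \<bullet> sgn P) \<le> 1 + c"
    "0 < 1 - eccentricity P d * (x \<bullet> sgn P)"
    using eccentricity_bounds[OF assms(1,2)] assms(4) by auto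
qed

lemma polar_radius_bounds:
  assumes "P \<noteq> 0" "0 < d" "norm x = 1" "eccentricity P d \<le> c" "c < 1"
  shows "d / (1 + c) \<le> polar_radius P d x" "polar_radius P d x \<le> d / (1 - c)"
  unfolding polar_radius_def using polar_denominator_bounds[OF assms(1-4)] assms
  by (auto intro!: divide_left_mono mult_pos_pos)

lemma polar_radius_pos:
  assumes "P \<noteq> 0" "0 < d" "norm x = 1"
  shows "0 < polar_radius P d x"
  unfolding polar_radius_def using polar_denominator_bounds[OF assms order_refl] assms by auto

text \<open>In reciprocal form the comparison of two ellipsoids over a direction is linear in
  \<open>x\<close>. Both the nesting of ellipsoids with common foci and the shape of the set of ties
  come from this.\<close>

lemma inverse_polar_radius:
  assumes "0 < d"
  shows "inverse (polar_radius P d x) = 1 / d - (eccentricity P d / d) * (x \<bullet> sgn P)"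
  using assms by (simp add: polar_radius_def field_simps)

text \<open>Expresses the linear coefficient of the reciprocal radius through \<open>1 / d\<close>,
  the variable in which its constant term is linear.\<close>

lemma eccentricity_over:
  assumes "0 < d"
  shows "eccentricity P d / d = sqrt ((1 / d)\<^sup>2 + (1 / norm P)\<^sup>2) - 1 / norm P"
proof -
  have "(1 / d)\<^sup>2 + (1 / norm P)\<^sup>2 = (1 + d\<^sup>2 / (norm P)\<^sup>2) / d\<^sup>2"
    using assms by (simp add: field_simps)
  then show ?thesis
    using assms by (simp add: eccentricity_def real_sqrt_divide diff_divide_distrib)
qed

text \<open>With \<open>u = 1 / d\<close> and \<open>q = 1 / norm P\<close> this is the strict monotonicity of \<open>polar_radius P\<close>.\<close>

lemma sqrt_sum_squares_diff:
  fixes u v q :: real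
  assumes "0 < v" "v < u" "0 < q"
  shows "\<bar>sqrt (u\<^sup>2 + q\<^sup>2) - sqrt (v\<^sup>2 + q\<^sup>2)\<bar> < u - v"
proof -
  let ?a = "sqrt (u\<^sup>2 + q\<^sup>2)" and ?b = "sqrt (v\<^sup>2 + q\<^sup>2)"
  have le: "?b \<le> ?a" using assms by (simp add: power_mono)
  have ub: "u < ?a" "v < ?b" using assms by (auto intro!: real_less_rsqrt)
  have "(?a - ?b) * (?a + ?b) = ?a\<^sup>2 - ?b\<^sup>2"
    by (simp add: power2_eq_square algebra_simps)
  also have "\<dots> = (u - v) * (u + v)"
    by (simp add: power2_eq_square algebra_simps)
  also have "\<dots> < (u - v) * (?a + ?b)"
    using ub assms by (intro mult_strict_left_mono) auto
  finally have "?a - ?b < u - v"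
    using ub assms by (auto simp: mult_less_cancel_right)
  then show ?thesis using le by simp
qed

lemma polar_radius_strict_mono:
  assumes "P \<noteq> 0" "0 < d" "d < e" "norm x = 1"
  shows "polar_radius P d x < polar_radius P e x"
proof -
  \<comment> \<open>The linear coefficients of the two reciprocal radii differ by \<open>s\<close>,
    which is too small to outweigh the difference \<open>1 / d - 1 / e\<close> of the constant
    terms.\<close>
  define s where "s = eccentricity P d / d - eccentricity P e / e"
  have "\<bar>s\<bar> < 1 / d - 1 / e"
    using sqrt_sum_squares_diff[of "1 / e" "1 / d" "1 / norm P"] assms
    by (simp add: s_def eccentricity_over divide_strict_left_mono del: power_one_over)
  moreover have "\<bar>s * (x \<bullet> sgn P)\<bar> \<le> \<bar>s\<bar> * 1"
    unfolding abs_mult using inner_sgn_bound[OF assms(4), of P] by (intro mult_left_mono) auto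
  ultimately have "s * (x \<bullet> sgn P) < 1 / d - 1 / e" by linarith
  then have "inverse (polar_radius P e x) < inverse (polar_radius P d x)"
    using assms unfolding s_def by (simp add: inverse_polar_radius algebra_simps)
  then show ?thesis
    using polar_radius_pos[of P e x] assms by (simp add: inverse_less_imp_less)
qed

lemma tendsto_eccentricity:
  assumes "P \<noteq> 0" "(d \<longlongrightarrow> e) F"
  shows "((\<lambda>n. eccentricity P (d n)) \<longlongrightarrow> eccentricity P e) F"
  unfolding eccentricity_def using assms by (auto intro!: tendsto_intros)

lemma tendsto_polar_radius:
  assumes "P \<noteq> 0" "0 < e" "norm y = 1" "(d \<longlongrightarrow> e) F" "(x \<longlongrightarrow> y) F"
  shows "((\<lambda>n. polar_radius P (d n) (x n)) \<longlongrightarrow> polar_radius P e y) F"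
  unfolding polar_radius_def using assms polar_denominator_bounds[OF assms(1-3) order_refl]
  by (intro tendsto_intros tendsto_eccentricity) auto

lemma continuous_on_polar_radius:
  assumes "P \<noteq> 0" "0 < d"
  shows "continuous_on S2 (polar_radius P d)"
  unfolding continuous_on_def using assms by (auto intro!: tendsto_polar_radius)

text \<open>With \<open>t = d / norm P\<close> the eccentricity solves
  \<open>(e + t)\<^sup>2 = 1 + t\<^sup>2\<close>. The resulting formula recovers the distance of the
  second focus and so separates foci on the same ray.\<close>

lemma eccentricity_relation:
  assumes "P \<noteq> 0" "0 < d"
  shows "norm P = 2 * d * eccentricity P d / (1 - (eccentricity P d)\<^sup>2)"
proof -
  define t where "t = d / norm P"
  define e where "e = eccentricity P d"
  have t: "0 < t" using assms by (simp add: t_def)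
  have e: "0 < e" "e < 1" using eccentricity_bounds[OF assms] by (auto simp: e_def)
  have "(e + t)\<^sup>2 = 1 + t\<^sup>2" by (simp add: e_def eccentricity_alt t_def)
  then have "1 - e\<^sup>2 = 2 * e * t" by (simp add: power2_sum)
  moreover have "e\<^sup>2 < 1" using e by (simp add: power_less_one_iff)
  ultimately show ?thesis
    using assms e unfolding e_def[symmetric] by (simp add: t_def field_simps)
qed

subsection \<open>Null sets of the surface measure\<close>

text \<open>The cone is contained in the frontier of the convex set of all \<open>x\<close> with \<open>b * norm x \<le> x \<bullet> a\<close>.\<close>

lemma negligible_round_cone:
  fixes a :: "real^3"
  assumes "0 < b"
  shows "negligible {x. x \<bullet> a = b * norm x}"
proof -
  define S where "S = {x. b * norm x \<le> x \<bullet> a}"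
  have "convex S"
  proof (rule convexI)
    fix x y :: "real^3" and u v :: real
    assume *: "x \<in> S" "y \<in> S" "0 \<le> u" "0 \<le> v" "u + v = 1"
    have "norm (u *\<^sub>R x + v *\<^sub>R y) \<le> u * norm x + v * norm y"
      using norm_triangle_ineq[of "u *\<^sub>R x" "v *\<^sub>R y"] * by simp
    then have "b * norm (u *\<^sub>R x + v *\<^sub>R y) \<le> b * (u * norm x + v * norm y)"
      using assms by (intro mult_left_mono) auto
    also have "\<dots> = u * (b * norm x) + v * (b * norm y)"
      by (simp add: algebra_simps)
    also have "\<dots> \<le> u * (x \<bullet> a) + v * (y \<bullet> a)"
      using * by (intro add_mono mult_left_mono) (auto simp: S_def)
    finally show "u *\<^sub>R x + v *\<^sub>R y \<in> S"
      by (simp add: S_def inner_add_left)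
  qed
  then have "negligible (frontier S)" by (rule negligible_convex_frontier)
  moreover have "x \<in> frontier S" if x: "x \<bullet> a = b * norm x" for x
  proof (rule ccontr)
    assume "x \<notin> frontier S"
    moreover have "x \<in> closure S" using x closure_subset[of S] by (auto simp: S_def)
    ultimately have "x \<in> interior S" by (simp add: frontier_def)
    then obtain r where r: "0 < r" "cball x r \<subseteq> S"
      using open_contains_cball[of "interior S"] interior_subset[of S] by auto
    \<comment> \<open>A small displacement \<open>u\<close> orthogonal to \<open>x\<close> lengthens
      both \<open>x + u\<close> and \<open>x - u\<close>, while their inner products with
      \<open>a\<close> still sum to \<open>2 * (x \<bullet> a)\<close>. So they cannot both lie in
      \<open>S\<close>.\<close>
    obtain v where v: "v \<noteq> 0" "orthogonal x v"
      using orthogonal_to_vector_exists[of x] by auto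
    define u where "u = (r / norm v) *\<^sub>R v"
    have u: "norm u = r" "x \<bullet> u = 0"
      using v r by (auto simp: u_def orthogonal_def)
    have "(norm (x + u))\<^sup>2 = (norm x)\<^sup>2 + r\<^sup>2" "(norm (x - u))\<^sup>2 = (norm x)\<^sup>2 + r\<^sup>2"
      using u by (simp_all add: power2_norm_eq_inner inner_add inner_diff inner_commute[of u x]
        flip: u(1))
    then have "norm x < norm (x + u)" "norm x < norm (x - u)"
      using r(1) by (auto intro!: power_less_imp_less_base[of "norm x" 2])
    moreover have "x + u \<in> S" "x - u \<in> S"
      using r u(1) by (auto simp: subset_iff dist_norm)
    ultimately have "b * (2 * norm x) < (x + u) \<bullet> a + (x - u) \<bullet> a"
      using assms unfolding S_def mem_Collect_eq
      by (smt (verit) mult_strict_left_mono distrib_left)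
    then show False using x by (simp add: inner_add_left inner_diff_left)
  qed
  ultimately show ?thesis
    by (meson negligible_subset mem_Collect_eq subsetI)
qed

lemma negligible_cone:
  fixes a :: "real^3"
  assumes "a \<noteq> 0"
  shows "negligible {x. x \<bullet> a = b * norm x}"
proof -
  consider "b > 0" | "b = 0" | "b < 0" by linarith
  then show ?thesis
  proof cases
    case 2
    then show ?thesis
      using negligible_hyperplane[of a 0] assms by (simp add: inner_commute)
  next
    case 3
    then show ?thesis
      using negligible_round_cone[of "- b" "- a"] by simp
  qed (rule negligible_round_cone)
qed

lemma sgn_measurable_sphere:
  "sgn \<in> measurable (restrict_space lborel (ball 0 1 - {0})) (restrict_space borel S2)"
proof (rule measurable_restrict_space2)
  show "sgn \<in> space (restrict_space lborel (ball 0 1 - {0})) \<rightarrow> S2"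
    by (auto simp: space_restrict_space norm_sgn)
  have "(\<lambda>x::real^3. sgn x) \<in> borel_measurable borel"
    unfolding sgn_div_norm by measurable
  then show "sgn \<in> borel_measurable (restrict_space lborel (ball 0 1 - {0}))"
    by (intro measurable_restrict_space1) simp
qed

text \<open>The surface measure of \<open>A\<close> is computed from the cone over \<open>A\<close>
  inside the punctured ball, so it vanishes as soon as the whole cone is negligible.\<close>

lemma null_sets_surface_measureI:
  assumes "A \<in> sets borel" "A \<subseteq> S2" "negligible {x. sgn x \<in> A}"
  shows "A \<in> null_sets surface_measure"
proof -
  let ?R = "restrict_space lborel (ball 0 1 - {0}) :: (real^3) measure"
  let ?D = "distr ?R (restrict_space borel S2) sgn"
  have A: "A \<in> sets (restrict_space borel S2)"
    using assms by (simp add: sets_restrict_space_iff)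
  have "sgn -` A \<inter> space ?R \<in> sets ?R"
    using sgn_measurable_sphere A by (rule measurable_sets)
  then have B: "sgn -` A \<inter> (ball 0 1 - {0}) \<in> sets lborel"
    by (simp add: sets_restrict_space_iff space_restrict_space)
  have "emeasure ?D A = emeasure ?R (sgn -` A \<inter> space ?R)"
    using sgn_measurable_sphere A by (rule emeasure_distr)
  also have "\<dots> = emeasure lborel (sgn -` A \<inter> (ball 0 1 - {0}))"
    by (subst emeasure_restrict_space) (auto simp: space_restrict_space)
  also have "\<dots> = 0"
  proof -
    have "negligible (sgn -` A \<inter> (ball 0 1 - {0}))"
      using assms(3) by (rule negligible_subset) auto
    then show ?thesis
      using B by (simp add: negligible_iff_null_sets null_sets_completion_iff null_setsD1)
  qed
  finally have "A \<in> null_sets (scale_measure 3 ?D)"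
    using A by (simp add: null_sets_def)
  then show ?thesis
    unfolding surface_measure_def by (rule null_sets_completionI)
qed

lemma sets_surface_measureI:
  assumes "A \<in> sets borel" "A \<subseteq> S2"
  shows "A \<in> sets surface_measure"
  unfolding surface_measure_def using assms
  by (intro sets_completionI_sets) (simp add: sets_restrict_space_iff)

lemma borel_measurable_surface_measureI:
  fixes h :: "real^3 \<Rightarrow> real"
  assumes "continuous_on S2 h"
  shows "h \<in> borel_measurable surface_measure"
proof -
  have "h \<in> borel_measurable (restrict_space borel S2)"
    using assms by (rule borel_measurable_continuous_on_restrict)
  then show ?thesis
    unfolding surface_measure_def
    by (intro measurable_completion) (simp cong: measurable_cong_sets)
qed

text \<open>Completeness makes every subset of a null set measurable. This handles the integrand of
  the reflector measure, which is controlled only up to null sets through its tracing set and its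
  normal.\<close>

lemma AE_eq_measurable_surface_measure:
  fixes g h :: "real^3 \<Rightarrow> real"
  assumes "g \<in> borel_measurable surface_measure" "AE x in surface_measure. h x = g x"
  shows "h \<in> borel_measurable surface_measure"
proof -
  obtain Z where Z: "{x \<in> space surface_measure. h x \<noteq> g x} \<subseteq> Z" "Z \<in> null_sets surface_measure"
    using assms(2) by (auto elim!: AE_E simp: null_sets_def)
  show ?thesis
  proof (rule measurableI)
    fix B :: "real set" assume "B \<in> sets borel"
    then have gB: "g -` B \<inter> space surface_measure \<in> sets surface_measure"
      using assms(1) by (rule measurable_sets[rotated])
    have null: "C \<in> sets surface_measure" if "C \<subseteq> Z" for C
      using that Z(2) null_sets_completion_subset unfolding surface_measure_def by blast
    have "h -` B \<inter> space surface_measure =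
      (g -` B \<inter> space surface_measure - Z) \<union> (h -` B \<inter> space surface_measure \<inter> Z)"
      using Z(1) by auto
    also have "\<dots> \<in> sets surface_measure"
      using gB Z(2) null by (intro sets.Un sets.Diff) auto
    finally show "h -` B \<inter> space surface_measure \<in> sets surface_measure" .
  qed simp
qed

text \<open>The cone over the circle satisfies \<open>x \<bullet> a = b * norm x\<close>, which is a
  negligible set.\<close>

lemma circle_null_sets:
  assumes "a \<noteq> 0"
  shows "{x \<in> S2. x \<bullet> a = b} \<in> null_sets surface_measure"
proof (rule null_sets_surface_measureI)
  have "{x \<in> S2. x \<bullet> a = b} = S2 \<inter> {x. x \<bullet> a = b}" by auto
  moreover have "closed (S2 \<inter> {x. x \<bullet> a = b})"
    by (intro closed_Int closed_sphere closed_Collect_eq continuous_intros)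
  ultimately have "closed {x \<in> S2. x \<bullet> a = b}" by simp
  then show "{x \<in> S2. x \<bullet> a = b} \<in> sets borel" by simp
  have "{x. sgn x \<in> {x \<in> S2. x \<bullet> a = b}} \<subseteq> {x. x \<bullet> a = b * norm x}"
    by (auto simp: sgn_div_norm field_simps)
  then show "negligible {x. sgn x \<in> {x \<in> S2. x \<bullet> a = b}}"
    using negligible_cone[OF assms, of b] by (rule negligible_subset[rotated])
qed auto

lemma polar_radius_tie_null_sets:
  assumes "P \<noteq> 0" "Q \<noteq> 0" "P \<noteq> Q" "0 < d" "0 < e"
  shows "{x \<in> S2. polar_radius P d x = polar_radius Q e x} \<in> null_sets surface_measure"
proof -
  \<comment> \<open>Equating the reciprocal radii gives the plane
    \<open>x \<bullet> a = 1 / d - 1 / e\<close>.\<close>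
  define a where "a = (eccentricity P d / d) *\<^sub>R sgn P - (eccentricity Q e / e) *\<^sub>R sgn Q"
  have "polar_radius P d x = polar_radius Q e x \<longleftrightarrow> x \<bullet> a = 1 / d - 1 / e" for x
  proof -
    have "polar_radius P d x = polar_radius Q e x \<longleftrightarrow>
      inverse (polar_radius P d x) = inverse (polar_radius Q e x)"
      by simp
    then show ?thesis
      unfolding a_def using assms by (auto simp: inverse_polar_radius algebra_simps)
  qed
  then have eq: "{x \<in> S2. polar_radius P d x = polar_radius Q e x} = {x \<in> S2. x \<bullet> a = 1 / d - 1 / e}"
    by simp
  show ?thesis
  proof (cases "a = 0")
    case False
    then show ?thesis unfolding eq by (rule circle_null_sets)
  next
    \<comment> \<open>If \<open>a = 0\<close>, the foci lie on one ray with equal ratios of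
      eccentricity to parameter. Equal parameters would then make the foci equal, so
      \<open>d \<noteq> e\<close> and there are no ties at all.\<close>
    case True
    have ecc: "0 < eccentricity P d" "0 < eccentricity Q e"
      using eccentricity_bounds assms by auto
    have *: "(eccentricity P d / d) *\<^sub>R sgn P = (eccentricity Q e / e) *\<^sub>R sgn Q"
      using True by (simp add: a_def)
    then have "norm ((eccentricity P d / d) *\<^sub>R sgn P) = norm ((eccentricity Q e / e) *\<^sub>R sgn Q)"
      by simp
    then have ratio: "eccentricity P d / d = eccentricity Q e / e"
      using assms ecc by (simp add: norm_sgn)
    then have sgn: "sgn P = sgn Q"
      using * assms ecc by simp
    have "d \<noteq> e"
    proof
      assume "d = e"
      then have "eccentricity P d = eccentricity Q e" using ratio assms by simp
      then have "norm P = norm Q" using eccentricity_relation assms \<open>d = e\<close> by metis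
      then have "P = Q" using sgn assms by (simp add: sgn_div_norm)
      then show False using assms by simp
    qed
    then have "{x \<in> S2. x \<bullet> a = 1 / d - 1 / e} = {}"
      using True assms by auto
    then show ?thesis unfolding eq by (simp only: null_sets.empty_sets)
  qed
qed

subsection \<open>The normal of an ellipsoid\<close>

text \<open>Over \<open>U\<close> the surface is part of the level set
  \<open>norm y - e * (y \<bullet> m) = d\<close>, whose gradient at \<open>p\<close> is
  \<open>x - e *\<^sub>R m\<close>; this gives a normal. It is the only outer one because
  \<open>U\<close> is open, so that \<open>p\<close> can be approached along the surface in every
  tangent direction.\<close>

lemma outer_normal_eq:
  assumes "\<Omega> \<subseteq> S2" "open U" "x \<in> S2" "x \<in> U" "U \<inter> S2 \<subseteq> closure \<Omega>"
    and P: "P \<noteq> 0" "0 < d"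
    and \<rho>: "\<And>z. z \<in> U \<inter> S2 \<Longrightarrow> \<rho> z = polar_radius P d z" "\<And>z. z \<in> closure \<Omega> \<Longrightarrow> 0 < \<rho> z"
  shows "outer_normal (polar_surface \<Omega> \<rho>) (\<rho> x *\<^sub>R x) = sgn (x - eccentricity P d *\<^sub>R sgn P)"
proof -
  define m where "m = sgn P"
  define e where "e = eccentricity P d"
  define n where "n = sgn (x - e *\<^sub>R m)"
  define r where "r = \<rho> x"
  define p where "p = r *\<^sub>R x"
  define S where "S = polar_surface \<Omega> \<rho>"
  have \<Omega>: "closure \<Omega> \<subseteq> S2" using assms(1) by (intro closure_minimal) auto
  have x: "norm x = 1" using assms(3) by simp
  have e: "0 < e" "e < 1" using eccentricity_bounds[OF P] by (auto simp: e_def)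
  have m: "norm m = 1" using P by (simp add: m_def norm_sgn)
  have den: "0 < 1 - e * (z \<bullet> m)" if "norm z = 1" for z
    using polar_denominator_bounds(3)[OF P that order_refl] by (simp add: e_def m_def)
  have r: "r = d / (1 - e * (x \<bullet> m))" "0 < r"
    using \<rho>(1)[of x] assms(3,4) den[OF x] P by (auto simp: r_def polar_radius_def e_def m_def)
  have sgn_p: "sgn p = x" using r(2) x by (simp add: p_def sgn_div_norm)
  have p0: "p \<noteq> 0" using r x by (auto simp: p_def)
  have xem: "x - e *\<^sub>R m \<noteq> 0"
  proof
    assume "x - e *\<^sub>R m = 0"
    then have "norm x = norm (e *\<^sub>R m)" by simp
    then show False using e x m by simp
  qed
  have nx: "0 < n \<bullet> x"
    using den[OF x] xem x
    by (simp add: n_def sgn_div_norm inner_diff_left inner_commute[of m x] dot_square_norm)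
  have sgn_lim: "(sgn \<longlongrightarrow> x) (at p within S)"
    unfolding sgn_p[symmetric] using p0 by (intro tendsto_intros) auto
  have lim_n: "((\<lambda>y. (y - p) \<bullet> n / norm (y - p)) \<longlongrightarrow> 0) (at p within S)"
  proof -
    define F where "F y = norm y - e * (y \<bullet> m)" for y :: "real^3"
    have "(F has_derivative (\<lambda>h. h \<bullet> (x - e *\<^sub>R m))) (at p within S)"
      unfolding F_def[abs_def] using p0 sgn_p
      by (auto intro!: derivative_eq_intros has_derivative_at_withinI[OF has_derivative_norm]
        simp: inner_diff_right fun_eq_iff)
    then have "((\<lambda>y. (F y - F p - (y - p) \<bullet> (x - e *\<^sub>R m)) /\<^sub>R norm (y - p)) \<longlongrightarrow> 0) (at p within S)"
      by (simp add: has_derivative_at_within)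
    \<comment> \<open>On the surface \<open>F y = F p = d\<close>, so only the linear term of the
      remainder is left. This factor turns it into the secant quotient with the unit vector
      \<open>n\<close>.\<close>
    then have "((\<lambda>y. (- inverse (norm (x - e *\<^sub>R m))) *
        ((F y - F p - (y - p) \<bullet> (x - e *\<^sub>R m)) /\<^sub>R norm (y - p))) \<longlongrightarrow> 0) (at p within S)"
      by (rule tendsto_mult_right_zero)
    moreover have "\<forall>\<^sub>F y in at p within S. (- inverse (norm (x - e *\<^sub>R m))) *
        ((F y - F p - (y - p) \<bullet> (x - e *\<^sub>R m)) /\<^sub>R norm (y - p)) = (y - p) \<bullet> n / norm (y - p)"
    proof -
      have F: "F (polar_radius P d z *\<^sub>R z) = d" if "norm z = 1" for z
      proof -
        have "F (polar_radius P d z *\<^sub>R z) = polar_radius P d z * (1 - e * (z \<bullet> m))"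
          using that polar_radius_pos[OF P that] by (simp add: F_def algebra_simps)
        also have "\<dots> = d"
          using den[OF that] by (simp add: polar_radius_def flip: e_def m_def)
        finally show ?thesis .
      qed
      have Fp: "F p = d"
        using F[OF x] \<rho>(1)[of x] assms(3,4) by (simp add: p_def r_def)
      have "\<forall>\<^sub>F y in at p within S. sgn y \<in> U"
        using topological_tendstoD[OF sgn_lim assms(2,4)] .
      moreover have "\<forall>\<^sub>F y in at p within S. y \<in> S"
        by (simp add: eventually_at_filter)
      ultimately show ?thesis
      proof eventually_elim
        case (elim y)
        then obtain z where z: "z \<in> closure \<Omega>" "y = \<rho> z *\<^sub>R z"
          by (auto simp: S_def polar_surface_def)
        then have nz: "norm z = 1" using \<Omega> by auto
        have "sgn y = z" using \<rho>(2)[OF z(1)] nz by (simp add: z sgn_scaleR sgn_div_norm)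
        then have "F y = d" using F[OF nz] \<rho>(1)[of z] elim nz z by simp
        then show ?case
          by (simp add: Fp n_def sgn_div_norm divide_inverse)
      qed
    qed
    ultimately show ?thesis by (rule Lim_transform_eventually)
  qed
  have unique: "n' = n"
    if n': "norm n' = 1" "0 < n' \<bullet> p" "((\<lambda>y. (y - p) \<bullet> n' / norm (y - p)) \<longlongrightarrow> 0) (at p within S)" for n'
  proof -
    \<comment> \<open>\<open>u\<close> is tangent to the sphere at \<open>x\<close>; the curve \<open>y\<close> on the ellipsoid over \<open>x + t *\<^sub>R u\<close> has
      velocity \<open>l *\<^sub>R x + r *\<^sub>R u\<close>, which is orthogonal to both normals, hence to \<open>u\<close>.\<close>
    define u where "u = (n \<bullet> x) *\<^sub>R n' - (n' \<bullet> x) *\<^sub>R n"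
    have ux: "u \<bullet> x = 0" "x \<bullet> u = 0" by (auto simp: u_def inner_diff_left inner_diff_right inner_commute)
    have "u = 0"
    proof (rule ccontr)
      assume u0: "u \<noteq> 0"
      \<comment> \<open>The factor \<open>q t\<close> brings \<open>x + t *\<^sub>R u\<close> onto
        the ellipsoid. The square root is the norm of \<open>x + t *\<^sub>R u\<close>, because
        \<open>u\<close> is orthogonal to the unit vector \<open>x\<close>.\<close>
      define q where "q t = d / (sqrt (1 + t\<^sup>2 * (u \<bullet> u)) - e * (x \<bullet> m + t * (u \<bullet> m)))" for t
      define y where "y t = q t *\<^sub>R (x + t *\<^sub>R u)" for t
      have norm_xu: "norm (x + t *\<^sub>R u) = sqrt (1 + t\<^sup>2 * (u \<bullet> u))" for t
        using x ux by (simp add: norm_eq_sqrt_inner inner_add power2_eq_square)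
      have q0: "q 0 = r" using r by (simp add: q_def)
      have qpos: "0 < q t" and qeq: "q t *\<^sub>R (x + t *\<^sub>R u) =
          polar_radius P d (sgn (x + t *\<^sub>R u)) *\<^sub>R sgn (x + t *\<^sub>R u)"
        and nonzero: "x + t *\<^sub>R u \<noteq> 0" for t
      proof -
        define v where "v = x + t *\<^sub>R u"
        have v: "0 < norm v" unfolding v_def norm_xu by (simp add: add_pos_nonneg)
        then show "x + t *\<^sub>R u \<noteq> 0" by (simp add: v_def)
        have "0 < 1 - e * (sgn v \<bullet> m)" using v by (intro den) (simp add: norm_sgn)
        then have dv: "0 < norm v - e * (v \<bullet> m)"
          using v by (simp add: sgn_div_norm field_simps)
        have qv: "q t = d / (norm v - e * (v \<bullet> m))"
          unfolding q_def v_def norm_xu by (simp add: inner_add_left)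
        show "0 < q t" using dv P by (simp add: qv)
        show "q t *\<^sub>R (x + t *\<^sub>R u) = polar_radius P d (sgn (x + t *\<^sub>R u)) *\<^sub>R sgn (x + t *\<^sub>R u)"
          unfolding v_def[symmetric] qv polar_radius_def e_def[symmetric] m_def[symmetric]
          using v dv by (simp add: sgn_div_norm field_simps)
      qed
      have y0: "y 0 = p" by (simp add: y_def q0 p_def)
      have "\<exists>l. (q has_real_derivative l) (at 0)"
        unfolding q_def[abs_def] using den[OF x]
        by (intro exI) (rule derivative_eq_intros refl | simp)+
      then obtain l where l: "(q has_real_derivative l) (at 0)" by blast
      then have q_lim: "(q \<longlongrightarrow> r) (at 0)"
        using DERIV_isCont q0 isCont_def by metis
      have quot: "((\<lambda>t. (q t - r) / t) \<longlongrightarrow> l) (at 0)"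
        using l q0 by (simp add: has_field_derivative_iff)
      have y_diff: "y t - p = (q t - r) *\<^sub>R x + (t * q t) *\<^sub>R u" for t
        by (simp add: y_def p_def algebra_simps)
      define v where "v = l *\<^sub>R x + r *\<^sub>R u"
      have v_lim: "((\<lambda>t. (y t - p) /\<^sub>R t) \<longlongrightarrow> v) (at 0)"
      proof (rule Lim_transform_eventually)
        show "((\<lambda>t. ((q t - r) / t) *\<^sub>R x + q t *\<^sub>R u) \<longlongrightarrow> v) (at 0)"
          unfolding v_def by (intro tendsto_intros quot q_lim)
        show "\<forall>\<^sub>F t in at 0. ((q t - r) / t) *\<^sub>R x + q t *\<^sub>R u = (y t - p) /\<^sub>R t"
          unfolding eventually_at_filter y_diff
          by (rule always_eventually) (auto simp: scaleR_add_right divide_inverse mult.commute)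
      qed
      have y_lim: "(y \<longlongrightarrow> p) (at 0)"
        unfolding y_def[abs_def] p_def by (auto intro!: tendsto_eq_intros q_lim)
      have "filterlim y (at p within S) (at 0)"
        unfolding filterlim_at
      proof (intro conjI y_lim)
        have "((\<lambda>t. sgn (x + t *\<^sub>R u)) \<longlongrightarrow> sgn (x + 0 *\<^sub>R u)) (at 0)"
          using x by (intro tendsto_intros) auto
        then have "((\<lambda>t. sgn (x + t *\<^sub>R u)) \<longlongrightarrow> x) (at 0)"
          using x by (simp add: sgn_div_norm)
        then have "\<forall>\<^sub>F t in at 0. sgn (x + t *\<^sub>R u) \<in> U"
          using assms(2,4) by (rule topological_tendstoD)
        moreover have "\<forall>\<^sub>F t in at (0::real). t \<noteq> 0" by (simp add: eventually_at_filter)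
        ultimately show "\<forall>\<^sub>F t in at 0. y t \<in> S \<and> y t \<noteq> p"
        proof eventually_elim
          case (elim t)
          define z where "z = sgn (x + t *\<^sub>R u)"
          have z: "z \<in> U \<inter> S2" using elim nonzero by (simp add: z_def norm_sgn)
          have "y t = \<rho> z *\<^sub>R z"
            unfolding \<rho>(1)[OF z] y_def qeq by (simp add: z_def)
          then have "y t \<in> S" using z assms(5) by (auto simp: S_def polar_surface_def)
          moreover have "y t \<noteq> p"
          proof
            assume "y t = p"
            then have "(y t - p) \<bullet> u = 0" by simp
            then have "t * q t * (u \<bullet> u) = 0"
              unfolding y_diff by (simp add: inner_add_left ux)
            then show False using elim qpos[of t] u0 by simp
          qed
          ultimately show ?case by simp
        qed
      qed
      then have orth: "v \<bullet> w = 0"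
        if "((\<lambda>y. (y - p) \<bullet> w / norm (y - p)) \<longlongrightarrow> 0) (at p within S)" for w
      proof -
        have "((\<lambda>t. (y t - p) \<bullet> w / norm (y t - p)) \<longlongrightarrow> 0) (at 0)"
          using that \<open>filterlim y (at p within S) (at 0)\<close> by (rule filterlim_compose)
        then have "((\<lambda>t. (y t - p) \<bullet> w / norm (y t - p) * norm ((y t - p) /\<^sub>R t)) \<longlongrightarrow> 0 * norm v) (at 0)"
          by (intro tendsto_intros v_lim)
        \<comment> \<open>The secant quotient involves only \<open>\<bar>t\<bar>\<close>, the
          velocity quotient involves \<open>t\<close>; absolute values make them agree for both
          signs of \<open>t\<close>.\<close>
        then have "((\<lambda>t. \<bar>(y t - p) \<bullet> w / norm (y t - p) * norm ((y t - p) /\<^sub>R t)\<bar>) \<longlongrightarrow> 0) (at 0)"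
          by (intro tendsto_rabs_zero) simp
        moreover have "\<bar>(y t - p) \<bullet> w / norm (y t - p) * norm ((y t - p) /\<^sub>R t)\<bar> =
          \<bar>((y t - p) /\<^sub>R t) \<bullet> w\<bar>" for t
          by (cases "y t = p") (simp_all add: abs_mult)
        ultimately have "((\<lambda>t. ((y t - p) /\<^sub>R t) \<bullet> w) \<longlongrightarrow> 0) (at 0)"
          by (simp only: tendsto_rabs_zero_iff)
        moreover have "((\<lambda>t. ((y t - p) /\<^sub>R t) \<bullet> w) \<longlongrightarrow> v \<bullet> w) (at 0)"
          by (intro tendsto_intros v_lim)
        ultimately show ?thesis
          using tendsto_unique trivial_limit_at by blast
      qed
      have "v \<bullet> u = 0"
        using orth[OF lim_n] orth[OF n'(3)] by (simp add: u_def inner_diff_right)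
      then have "r * (u \<bullet> u) = 0" by (simp add: v_def inner_add_left ux)
      then show False using u0 r(2) by simp
    qed
    then have *: "(n \<bullet> x) *\<^sub>R n' = (n' \<bullet> x) *\<^sub>R n" by (simp add: u_def)
    have n'x: "0 < n' \<bullet> x" using n'(2) r(2) by (simp add: p_def zero_less_mult_iff)
    have "norm n = 1" using xem by (simp add: n_def norm_sgn)
    then have "n \<bullet> x = n' \<bullet> x"
      using arg_cong[OF *, of norm] n'(1) n'x nx by simp
    then have "(n \<bullet> x) *\<^sub>R n' = (n \<bullet> x) *\<^sub>R n" using * by simp
    then show "n' = n" using nx by (simp only: scaleR_cancel_left) simp
  qed
  have "outer_normal S p = n"
    unfolding outer_normal_def
  proof (rule the_equality)
    show "norm n = 1 \<and> 0 < n \<bullet> p \<and> ((\<lambda>y. (y - p) \<bullet> n / norm (y - p)) \<longlongrightarrow> 0) (at p within S)"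
      using lim_n nx r(2) xem by (simp add: n_def norm_sgn p_def)
  qed (use unique in auto)
  then show ?thesis by (simp add: S_def p_def r_def n_def e_def m_def)
qed

subsection \<open>Reflector measures of the single targets\<close>

text \<open>The factor multiplying \<open>f\<close> in the reflector measure wherever this ellipsoid
  is the one that forms the reflector.\<close>

definition reflector_density :: "real^3 \<Rightarrow> real \<Rightarrow> real^3 \<Rightarrow> real" where
  "reflector_density P d x = (x \<bullet> sgn (x - eccentricity P d *\<^sub>R sgn P)) / (polar_radius P d x)\<^sup>2"

lemma norm_minus_focus_bounds:
  assumes "P \<noteq> 0" "0 < d" "norm x = 1"
  shows "0 < norm (x - eccentricity P d *\<^sub>R sgn P)"
    "norm (x - eccentricity P d *\<^sub>R sgn P) \<le> 1 + eccentricity P d"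
proof -
  have "norm (eccentricity P d *\<^sub>R sgn P) = eccentricity P d"
    using eccentricity_bounds[OF assms(1,2)] assms by (simp add: norm_sgn)
  then show "0 < norm (x - eccentricity P d *\<^sub>R sgn P)"
    "norm (x - eccentricity P d *\<^sub>R sgn P) \<le> 1 + eccentricity P d"
    using norm_triangle_ineq4[of x "eccentricity P d *\<^sub>R sgn P"]
      norm_triangle_ineq2[of x "eccentricity P d *\<^sub>R sgn P"]
      eccentricity_bounds[OF assms(1,2)] assms(3) by auto
qed

text \<open>The inner product equals the polar denominator divided by the length of
  \<open>x - eccentricity P d *\<^sub>R sgn P\<close>. The first is at least \<open>1 - c\<close>,
  the second at most \<open>1 + c\<close>.\<close>

lemma cos_normal_bounds:
  assumes "P \<noteq> 0" "0 < d" "norm x = 1" "eccentricity P d \<le> c" "c < 1"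
  shows "(1 - c) / (1 + c) \<le> x \<bullet> sgn (x - eccentricity P d *\<^sub>R sgn P)"
    "x \<bullet> sgn (x - eccentricity P d *\<^sub>R sgn P) \<le> 1"
proof -
  let ?v = "x - eccentricity P d *\<^sub>R sgn P"
  note v = norm_minus_focus_bounds[OF assms(1-3)]
  have "(1 - c) / (1 + c) \<le> (1 - eccentricity P d * (x \<bullet> sgn P)) / norm ?v"
    using v polar_denominator_bounds[OF assms(1-4)] assms by (intro frac_le) auto
  also have "\<dots> = x \<bullet> sgn ?v"
    using assms(3) by (simp add: sgn_div_norm[of ?v] inner_diff_right dot_square_norm divide_inverse mult.commute)
  finally show "(1 - c) / (1 + c) \<le> x \<bullet> sgn ?v" .
  show "x \<bullet> sgn ?v \<le> 1"
    using norm_cauchy_schwarz[of x "sgn ?v"] assms(3) v by (simp add: norm_sgn)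
qed

lemma reflector_density_le:
  assumes "P \<noteq> 0" "0 < d" "norm x = 1" "0 < r" "r \<le> polar_radius P d x"
  shows "reflector_density P d x \<le> 1 / r\<^sup>2"
proof -
  have "r\<^sup>2 \<le> (polar_radius P d x)\<^sup>2" using assms by (intro power_mono) auto
  then show ?thesis
    unfolding reflector_density_def using assms(4)
      cos_normal_bounds(2)[OF assms(1-3) order_refl eccentricity_bounds(2)[OF assms(1,2)]]
    by (intro frac_le) auto
qed

lemma reflector_density_ge:
  assumes "P \<noteq> 0" "0 < d" "norm x = 1" "eccentricity P d \<le> c" "c < 1" "polar_radius P d x \<le> R"
  shows "(1 - c) / (1 + c) / R\<^sup>2 \<le> reflector_density P d x"
proof -
  have "(polar_radius P d x)\<^sup>2 \<le> R\<^sup>2"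
    using polar_radius_pos[OF assms(1-3)] assms(6) by (intro power_mono) auto
  moreover have "0 \<le> (1 - c) / (1 + c)"
    using eccentricity_bounds(1)[OF assms(1,2)] assms(4,5) by simp
  ultimately show ?thesis
    unfolding reflector_density_def
    using cos_normal_bounds(1)[OF assms(1-5)] polar_radius_pos[OF assms(1-3)]
    by (intro frac_le) auto
qed

lemma reflector_density_nonneg:
  assumes "P \<noteq> 0" "0 < d" "norm x = 1"
  shows "0 \<le> reflector_density P d x"
proof -
  note e = eccentricity_bounds[OF assms(1,2)]
  have "0 \<le> (1 - eccentricity P d) / (1 + eccentricity P d) / (polar_radius P d x)\<^sup>2"
    using e by simp
  also have "\<dots> \<le> reflector_density P d x"
    using reflector_density_ge[OF assms order_refl e(2) order_refl] .
  finally show ?thesis .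
qed

lemma tendsto_reflector_density:
  assumes "P \<noteq> 0" "0 < e" "norm y = 1" "(d \<longlongrightarrow> e) F" "(x \<longlongrightarrow> y) F"
  shows "((\<lambda>n. reflector_density P (d n) (x n)) \<longlongrightarrow> reflector_density P e y) F"
  unfolding reflector_density_def
  using assms polar_radius_pos[OF assms(1-3)] norm_minus_focus_bounds(1)[OF assms(1-3)]
  by (intro tendsto_intros tendsto_polar_radius tendsto_eccentricity) auto

lemma continuous_on_reflector_density:
  assumes "P \<noteq> 0" "0 < d"
  shows "continuous_on S2 (reflector_density P d)"
  unfolding continuous_on_def using assms by (auto intro!: tendsto_reflector_density)

section \<open>Visible sets, tracing sets and normals up to null sets\<close>

locale reflector =
  fixes \<Omega> :: "(real^3) set" and f :: "real^3 \<Rightarrow> real" and N :: nat and P :: "nat \<Rightarrow> real^3"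
  assumes Omega: "\<Omega> \<subseteq> S2"
    and frontier_null: "(top_of_set S2) frontier_of \<Omega> \<in> null_sets surface_measure"
    and f_integrable: "set_integrable surface_measure (closure \<Omega>) f"
    and f_pos: "AE x in surface_measure. x \<in> closure \<Omega> \<longrightarrow> f x > 0"
    and N: "1 \<le> N"
    and P_inj: "inj_on P {1..N}"
    and P_nonzero: "\<And>i. i \<in> {1..N} \<Longrightarrow> P i \<noteq> 0"
begin

abbreviation "rad w i \<equiv> polar_radius (P i) (w i)"

text \<open>Ties are included, so that these sets are closed and together cover
  \<open>closure \<Omega>\<close>; their overlaps are null for positive parameters.\<close>

definition visible :: "(nat \<Rightarrow> real) \<Rightarrow> nat \<Rightarrow> (real^3) set" where
  "visible w i = {x \<in> closure \<Omega>. \<forall>j\<in>{1..N}. rad w i x \<le> rad w j x}"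

definition F :: "real^3 \<Rightarrow> real" where
  "F x = indicator (closure \<Omega>) x * f x"

definition mass :: "(nat \<Rightarrow> real) \<Rightarrow> nat \<Rightarrow> real" where
  "mass w i = reflector_measure \<Omega> f N P w {P i}"

lemma closure_Omega: "closure \<Omega> \<subseteq> S2"
  using Omega by (intro closure_minimal) auto

lemma norm_closure: "x \<in> closure \<Omega> \<Longrightarrow> norm x = 1"
  using closure_Omega by auto

lemma F_integrable: "integrable surface_measure F"
  using f_integrable by (simp add: set_integrable_def F_def[abs_def])

lemma F_measurable [measurable]: "F \<in> borel_measurable surface_measure"
  using F_integrable by simp

lemma F_nonneg: "AE x in surface_measure. 0 \<le> F x"
  using f_pos by eventually_elim (auto simp: F_def indicator_def)

lemma F_outside: "x \<notin> closure \<Omega> \<Longrightarrow> F x = 0"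
  by (simp add: F_def)

lemma integral_F_nonneg: "0 \<le> integral\<^sup>L surface_measure F"
  using F_nonneg by (rule integral_nonneg_AE)

lemma visible_subset: "visible w i \<subseteq> closure \<Omega>"
  by (auto simp: visible_def)

lemma refl_radius_visible:
  assumes "i \<in> {1..N}" "x \<in> visible w i"
  shows "refl_radius N P w x = rad w i x"
  unfolding refl_radius_def using assms by (intro Min_eqI) (auto simp: visible_def)

lemma visibleI_refl_radius:
  assumes "x \<in> closure \<Omega>" "rad w i x = refl_radius N P w x"
  shows "x \<in> visible w i"
  using assms by (auto simp: visible_def refl_radius_def)

lemma refl_radius_attained:
  obtains i where "i \<in> {1..N}" "refl_radius N P w x = rad w i x"
proof -
  have "refl_radius N P w x \<in> (\<lambda>i. rad w i x) ` {1..N}"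
    unfolding refl_radius_def using N by (intro Min_in) auto
  then show ?thesis using that by auto
qed

lemma visible_measurable [measurable]:
  assumes "\<forall>j\<in>{1..N}. 0 < w j" "i \<in> {1..N}"
  shows "visible w i \<in> sets surface_measure"
proof (rule sets_surface_measureI)
  have "visible w i = closure \<Omega> \<inter> (\<Inter>j\<in>{1..N}. {x \<in> S2. rad w i x \<le> rad w j x})"
    using closure_Omega N by (auto simp: visible_def)
  moreover have "closed {x \<in> S2. rad w i x \<le> rad w j x}" if "j \<in> {1..N}" for j
    using that assms P_nonzero
    by (intro continuous_on_closed_Collect_le continuous_on_polar_radius closed_sphere) auto
  ultimately have "closed (visible w i)"
    by (simp add: closed_Int closed_INT)
  then show "visible w i \<in> sets borel" by simp
  show "visible w i \<subseteq> S2" using visible_subset closure_Omega by blast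
qed

lemma density_measurable [measurable]:
  assumes "i \<in> {1..N}" "0 < d"
  shows "reflector_density (P i) d \<in> borel_measurable surface_measure"
  using assms P_nonzero
  by (intro borel_measurable_surface_measureI continuous_on_reflector_density) auto

lemma AE_no_tie:
  assumes "i \<in> {1..N}" "j \<in> {1..N}" "i \<noteq> j" "0 < d" "0 < e"
  shows "AE x in surface_measure. x \<in> closure \<Omega> \<longrightarrow> polar_radius (P i) d x \<noteq> polar_radius (P j) e x"
proof -
  have "P i \<noteq> P j" using inj_on_eq_iff[OF P_inj assms(1,2)] assms(3) by simp
  then have "{x \<in> S2. polar_radius (P i) d x = polar_radius (P j) e x} \<in> null_sets surface_measure"
    using assms(4,5) P_nonzero[OF assms(1)] P_nonzero[OF assms(2)]
    by (intro polar_radius_tie_null_sets)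
  then have "AE x in surface_measure. x \<notin> {x \<in> S2. polar_radius (P i) d x = polar_radius (P j) e x}"
    by (rule AE_not_in)
  then show ?thesis
    using closure_Omega by (elim eventually_mono) blast
qed

lemma AE_no_ties:
  assumes "\<forall>j\<in>{1..N}. 0 < w j"
  shows "AE x in surface_measure. x \<in> closure \<Omega> \<longrightarrow>
    (\<forall>i\<in>{1..N}. \<forall>j\<in>{1..N}. i \<noteq> j \<longrightarrow> rad w i x \<noteq> rad w j x)"
proof -
  have "AE x in surface_measure. \<forall>i\<in>{1..N}. \<forall>j\<in>{1..N}. i \<noteq> j \<longrightarrow>
    (x \<in> closure \<Omega> \<longrightarrow> rad w i x \<noteq> rad w j x)"
    using assms by (intro AE_finite_allI) (auto intro!: AE_no_tie)
  then show ?thesis by eventually_elim auto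
qed

text \<open>The null boundary enters here. Almost every point of \<open>closure \<Omega>\<close> has
  a neighbourhood in the sphere over which the reflector is defined, as needed to determine its
  normal.\<close>

lemma AE_interior: "AE x in surface_measure. x \<in> closure \<Omega> \<longrightarrow> x \<in> (top_of_set S2) interior_of \<Omega>"
proof -
  have "(top_of_set S2) closure_of \<Omega> = closure \<Omega>"
    using closure_Omega Omega by (simp add: closure_of_subtopology Int_absorb1)
  then have "closure \<Omega> - (top_of_set S2) interior_of \<Omega> = (top_of_set S2) frontier_of \<Omega>"
    by (simp add: frontier_of_def)
  then show ?thesis using AE_not_in[OF frontier_null] by (elim eventually_mono) blast
qed

text \<open>Ellipsoids with the same foci are strictly nested, so the larger one would touch the
  surface at a point strictly outside the smaller one, which bounds it.\<close>

lemma supports_at_unique: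
  assumes "i \<in> {1..N}" "0 < d" "0 < e" "x \<in> closure \<Omega>" "y \<in> closure \<Omega>"
    "supports_at \<Omega> \<rho> (P i) d x" "supports_at \<Omega> \<rho> (P i) e y"
  shows "d = e"
proof (rule linorder_cases[of d e])
  assume "d < e"
  then have "polar_radius (P i) d y < polar_radius (P i) e y"
    using assms P_nonzero norm_closure by (intro polar_radius_strict_mono) auto
  then show ?thesis using assms(5-7) unfolding supports_at_def by force
next
  assume "e < d"
  then have "polar_radius (P i) e x < polar_radius (P i) d x"
    using assms P_nonzero norm_closure by (intro polar_radius_strict_mono) auto
  then show ?thesis using assms(4,6,7) unfolding supports_at_def by force
qed

text \<open>
  An ellipsoid with second focus \<open>P i\<close> may support the reflector without being the \<open>i\<close>-th one, but
  its parameter is then unique, so it touches the reflector only on a null set of ties.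
\<close>

lemma AE_tracing:
  assumes "\<forall>j\<in>{1..N}. 0 < w j" "i \<in> {1..N}"
  shows "AE x in surface_measure. x \<in> tracing \<Omega> (refl_radius N P w) (P i) \<longleftrightarrow> x \<in> visible w i"
proof -
  let ?\<rho> = "refl_radius N P w"
  \<comment> \<open>The only parameter with which an ellipsoid with focus \<open>P i\<close> can
    support the reflector; if there is no such ellipsoid, the value 1 serves vacuously.\<close>
  obtain e where e: "0 < e"
    "\<And>d x. 0 < d \<Longrightarrow> x \<in> closure \<Omega> \<Longrightarrow> supports_at \<Omega> ?\<rho> (P i) d x \<Longrightarrow> d = e"
  proof (cases "\<exists>e>0. \<exists>x\<in>closure \<Omega>. supports_at \<Omega> ?\<rho> (P i) e x")
    case True
    then show ?thesis using that supports_at_unique[OF assms(2)] by blast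
  next
    case False
    then show ?thesis using that[of 1] by auto
  qed
  have "AE x in surface_measure. \<forall>j\<in>{1..N}. i \<noteq> j \<longrightarrow>
    (x \<in> closure \<Omega> \<longrightarrow> polar_radius (P i) e x \<noteq> rad w j x)"
    using assms e(1) by (intro AE_finite_allI) (auto intro!: AE_no_tie)
  then show ?thesis
  proof eventually_elim
    case (elim x)
    show ?case
    proof
      assume "x \<in> tracing \<Omega> ?\<rho> (P i)"
      then obtain d where d: "x \<in> closure \<Omega>" "0 < d" "supports_at \<Omega> ?\<rho> (P i) d x"
        by (auto simp: tracing_def)
      then have "d = e" using e(2) by blast
      obtain j where j: "j \<in> {1..N}" "?\<rho> x = rad w j x" by (rule refl_radius_attained)
      have "polar_radius (P i) e x = rad w j x"
        using d j \<open>d = e\<close> by (simp add: supports_at_def)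
      then have "i = j" using elim j d by auto
      then show "x \<in> visible w i" using j d by (intro visibleI_refl_radius) auto
    next
      assume x: "x \<in> visible w i"
      have "supports_at \<Omega> ?\<rho> (P i) (w i) x"
        using refl_radius_visible[OF assms(2) x] assms(2)
        by (auto simp: supports_at_def refl_radius_def)
      then show "x \<in> tracing \<Omega> ?\<rho> (P i)"
        using x assms by (auto simp: tracing_def visible_def)
    qed
  qed
qed

lemma refl_radius_pos:
  assumes "\<forall>j\<in>{1..N}. 0 < w j" "x \<in> closure \<Omega>"
  shows "0 < refl_radius N P w x"
proof -
  obtain i where "i \<in> {1..N}" "refl_radius N P w x = rad w i x" by (rule refl_radius_attained)
  then show ?thesis using assms P_nonzero norm_closure by (auto intro!: polar_radius_pos)
qed

text \<open>At an interior point without ties the \<open>i\<close>-th radius is the strict minimum,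
  and by continuity it stays so nearby. The reflector coincides there with the \<open>i\<close>-th
  ellipsoid and inherits its normal.\<close>

lemma AE_outer_normal:
  assumes "\<forall>j\<in>{1..N}. 0 < w j" "i \<in> {1..N}"
  shows "AE x in surface_measure. x \<in> visible w i \<longrightarrow>
    outer_normal (polar_surface \<Omega> (refl_radius N P w)) (refl_radius N P w x *\<^sub>R x) =
      sgn (x - eccentricity (P i) (w i) *\<^sub>R sgn (P i))"
  using AE_no_ties[OF assms(1)] AE_interior
proof eventually_elim
  case (elim x)
  show ?case
  proof
    assume x: "x \<in> visible w i"
    then have xc: "x \<in> closure \<Omega>" by (simp add: visible_def)
    obtain T where T: "openin (top_of_set S2) T" "x \<in> T" "T \<subseteq> \<Omega>"
      using elim(2) xc by (auto simp: interior_of_def)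
    obtain V where V: "open V" "T = S2 \<inter> V" using T(1) by (auto simp: openin_open)
    have "\<exists>W. open W \<and> W \<inter> S2 = {z \<in> S2. rad w i z < rad w j z}" if "j \<in> {1..N}" for j
    proof -
      have "continuous_on S2 (\<lambda>z. rad w j z - rad w i z)"
        using that assms P_nonzero
        by (intro continuous_on_diff continuous_on_polar_radius) auto
      then have "openin (top_of_set S2) (S2 \<inter> (\<lambda>z. rad w j z - rad w i z) -` {0<..})"
        by (rule continuous_openin_preimage_gen) simp
      then obtain W where "open W" "S2 \<inter> (\<lambda>z. rad w j z - rad w i z) -` {0<..} = S2 \<inter> W"
        by (auto simp: openin_open)
      moreover have "S2 \<inter> (\<lambda>z. rad w j z - rad w i z) -` {0<..} = {z \<in> S2. rad w i z < rad w j z}"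
        by auto
      ultimately show ?thesis by (intro exI[of _ W]) auto
    qed
    then have "\<forall>j\<in>{1..N}. \<exists>W. open W \<and> W \<inter> S2 = {z \<in> S2. rad w i z < rad w j z}" by blast
    from bchoice[OF this] obtain W where W: "\<And>j. j \<in> {1..N} \<Longrightarrow> open (W j)"
      "\<And>j. j \<in> {1..N} \<Longrightarrow> W j \<inter> S2 = {z \<in> S2. rad w i z < rad w j z}"
      by blast
    \<comment> \<open>An open set of the ambient space whose trace on the sphere lies in
      \<open>\<Omega>\<close> and on which the \<open>i\<close>-th radius is strictly below all
      others.\<close>
    define U where "U = V \<inter> (\<Inter>j\<in>{1..N}-{i}. W j)"
    have less: "rad w i x < rad w j x" if "j \<in> {1..N} - {i}" for j
    proof -
      have "rad w i x \<le> rad w j x" using x that by (simp add: visible_def)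
      moreover have "rad w i x \<noteq> rad w j x" using elim(1) xc assms(2) that by auto
      ultimately show ?thesis by simp
    qed
    have U_less: "rad w i z < rad w j z" if "z \<in> U \<inter> S2" "j \<in> {1..N} - {i}" for z j
      using that W(2)[of j] by (auto simp: U_def)
    show "outer_normal (polar_surface \<Omega> (refl_radius N P w)) (refl_radius N P w x *\<^sub>R x) =
      sgn (x - eccentricity (P i) (w i) *\<^sub>R sgn (P i))"
    proof (rule outer_normal_eq[OF Omega, of U])
      show "open U" unfolding U_def using V W by (intro open_Int open_INT) auto
      show "x \<in> S2" using xc closure_Omega by auto
      then have "x \<in> W j" if "j \<in> {1..N} - {i}" for j
        using less[OF that] W(2)[of j] that by blast
      then show "x \<in> U" using T(2) V(2) by (auto simp: U_def)
      show sub: "U \<inter> S2 \<subseteq> closure \<Omega>"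
        using T(3) V(2) closure_subset[of \<Omega>] by (auto simp: U_def)
      show "refl_radius N P w z = rad w i z" if "z \<in> U \<inter> S2" for z
      proof (rule refl_radius_visible[OF assms(2)])
        have "rad w i z \<le> rad w j z" if "j \<in> {1..N}" for j
          using U_less[of z j] \<open>z \<in> U \<inter> S2\<close> that by (cases "j = i") (auto simp: less_imp_le)
        then show "z \<in> visible w i" using sub that by (auto simp: visible_def)
      qed
    qed (use assms P_nonzero refl_radius_pos in auto)
  qed
qed

section \<open>The masses as integrals: monotonicity and bounds\<close>

lemma integrable_visible:
  assumes "\<forall>j\<in>{1..N}. 0 < w j" "i \<in> {1..N}"
  shows "integrable surface_measure
    (\<lambda>x. indicator (visible w i) x * reflector_density (P i) (w i) x * F x)"
proof (rule Bochner_Integration.integrable_bound)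
  \<comment> \<open>The general lower bound for the polar radius, with the eccentricity itself in
    the role of \<open>c\<close>.\<close>
  define r where "r = w i / (1 + eccentricity (P i) (w i))"
  have pos: "P i \<noteq> 0" "0 < w i" using assms P_nonzero by auto
  note e = eccentricity_bounds[OF pos]
  show "integrable surface_measure (\<lambda>x. (1 / r\<^sup>2) * F x)"
    using F_integrable by simp
  show "AE x in surface_measure. norm (indicator (visible w i) x * reflector_density (P i) (w i) x * F x)
    \<le> norm ((1 / r\<^sup>2) * F x)"
  proof (rule AE_I2)
    fix x
    have "\<bar>reflector_density (P i) (w i) x\<bar> \<le> 1 / r\<^sup>2" if "x \<in> visible w i"
    proof -
      have x: "norm x = 1" using that visible_subset norm_closure by blast
      have "r \<le> polar_radius (P i) (w i) x"
        using polar_radius_bounds(1)[OF pos x order_refl e(2)] by (simp add: r_def)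
      moreover have "0 < r" using pos e by (simp add: r_def)
      ultimately show ?thesis
        using reflector_density_le[OF pos x] reflector_density_nonneg[OF pos x] by simp
    qed
    then show "norm (indicator (visible w i) x * reflector_density (P i) (w i) x * F x)
      \<le> norm ((1 / r\<^sup>2) * F x)"
      by (auto simp: indicator_def abs_mult simp del: times_divide_eq_left intro: mult_right_mono)
  qed
  show "(\<lambda>x. indicator (visible w i) x * reflector_density (P i) (w i) x * F x)
    \<in> borel_measurable surface_measure"
    using assms visible_measurable
    by (intro borel_measurable_times borel_measurable_indicator density_measurable F_measurable) auto
qed

text \<open>Almost everywhere the tracing set may be replaced by the visible set and the normal by
  that of the ellipsoid. From here on neither tracing sets nor normals occur in the
  estimates.\<close>

lemma mass_eq:
  assumes "\<forall>j\<in>{1..N}. 0 < w j" "i \<in> {1..N}"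
  shows "mass w i =
    (LINT x|surface_measure. indicator (visible w i) x * reflector_density (P i) (w i) x * F x)"
proof -
  let ?\<rho> = "refl_radius N P w"
  let ?h = "\<lambda>x. indicator (tracing \<Omega> ?\<rho> (P i)) x *\<^sub>R
    (f x * (x \<bullet> outer_normal (polar_surface \<Omega> ?\<rho>) (?\<rho> x *\<^sub>R x) / (?\<rho> x)\<^sup>2))"
  let ?g = "\<lambda>x. indicator (visible w i) x * reflector_density (P i) (w i) x * F x"
  have eq: "AE x in surface_measure. ?h x = ?g x"
    using AE_tracing[OF assms] AE_outer_normal[OF assms]
  proof eventually_elim
    case (elim x)
    then show ?case
      using refl_radius_visible[OF assms(2), of x w] visible_subset[of w i]
      by (auto simp: indicator_def F_def reflector_density_def)
  qed
  have g: "?g \<in> borel_measurable surface_measure"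
    using integrable_visible[OF assms] by simp
  have "mass w i = integral\<^sup>L surface_measure ?h"
    by (simp add: mass_def reflector_measure_def set_lebesgue_integral_def Let_def)
  also have "\<dots> = integral\<^sup>L surface_measure ?g"
    using AE_eq_measurable_surface_measure[OF g eq] g eq by (rule integral_cong_AE)
  finally show ?thesis .
qed

lemma visible_nonempty:
  assumes "\<forall>j\<in>{1..N}. 0 < w j" "i \<in> {1..N}" "0 < mass w i"
  obtains x where "x \<in> visible w i"
proof (cases "visible w i = {}")
  case True
  then have "mass w i = 0" unfolding mass_eq[OF assms(1,2)] by simp
  then show ?thesis using assms(3) by simp
qed (use that in blast)

text \<open>The \<open>i\<close>-th ellipsoid can be visible only where it ties with the
  \<open>j\<close>-th, and ties are null.\<close>

lemma mass_dominated:
  assumes "\<forall>j\<in>{1..N}. 0 < w j" "i \<in> {1..N}" "j \<in> {1..N}" "i \<noteq> j"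
    and "\<And>x. x \<in> closure \<Omega> \<Longrightarrow> rad w j x \<le> rad w i x"
  shows "mass w i = 0"
proof -
  have "mass w i = (LINT x|surface_measure. 0)"
    unfolding mass_eq[OF assms(1,2)]
  proof (rule integral_cong_AE)
    show "AE x in surface_measure. indicator (visible w i) x * reflector_density (P i) (w i) x * F x = 0"
      using AE_no_ties[OF assms(1)]
    proof eventually_elim
      case (elim x)
      have "x \<notin> visible w i"
      proof
        assume x: "x \<in> visible w i"
        then have "rad w i x \<le> rad w j x" "x \<in> closure \<Omega>"
          using assms(3) by (auto simp: visible_def)
        then show False using assms(2-5) elim by force
      qed
      then show ?case by simp
    qed
  qed (use integrable_visible[OF assms(1,2)] in auto)
  then show ?thesis by simp
qed

text \<open>A smaller \<open>i\<close>-th ellipsoid can only hide parts of the \<open>j\<close>-th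
  one. On what remains visible the density is unchanged, since it depends on \<open>w j\<close>
  alone.\<close>

lemma mass_update_le:
  assumes "\<forall>j\<in>{1..N}. 0 < w j" "i \<in> {1..N}" "j \<in> {1..N}" "i \<noteq> j" "0 < d" "d \<le> w i"
  shows "mass (w(i := d)) j \<le> mass w j"
proof -
  let ?w = "w(i := d)"
  have w: "\<forall>j\<in>{1..N}. 0 < ?w j" using assms by simp
  have "polar_radius (P i) d x \<le> rad w i x" if "x \<in> closure \<Omega>" for x
    using polar_radius_strict_mono[OF P_nonzero[OF assms(2)] assms(5) _ norm_closure[OF that]] assms(6)
    by (cases "d = w i") (auto simp: less_imp_le)
  then have sub: "visible ?w j \<subseteq> visible w j"
    using assms(2-4) by (fastforce simp: visible_def split: if_splits)
  show ?thesis
    unfolding mass_eq[OF assms(1,3)] mass_eq[OF w assms(3)]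
  proof (rule integral_mono_AE)
    show "AE x in surface_measure. indicator (visible ?w j) x * reflector_density (P j) (?w j) x * F x
      \<le> indicator (visible w j) x * reflector_density (P j) (w j) x * F x"
      using F_nonneg
    proof eventually_elim
      case (elim x)
      have "0 \<le> reflector_density (P j) (w j) x" if "x \<in> visible w j"
        using that assms P_nonzero visible_subset norm_closure
        by (intro reflector_density_nonneg) blast+
      then show ?case using elim sub assms(4) by (auto simp: indicator_def)
    qed
  qed (use integrable_visible assms(1,3) w in blast)+
qed

lemma mass_le:
  assumes "\<forall>j\<in>{1..N}. 0 < w j" "i \<in> {1..N}" "0 < r"
    and "\<And>x. x \<in> closure \<Omega> \<Longrightarrow> r \<le> rad w i x"
  shows "mass w i \<le> integral\<^sup>L surface_measure F / r\<^sup>2"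
proof -
  have pos: "P i \<noteq> 0" "0 < w i" using assms P_nonzero by auto
  have "mass w i \<le> (LINT x|surface_measure. F x / r\<^sup>2)"
    unfolding mass_eq[OF assms(1,2)]
  proof (rule integral_mono_AE)
    show "AE x in surface_measure. indicator (visible w i) x * reflector_density (P i) (w i) x * F x
      \<le> F x / r\<^sup>2"
      using F_nonneg
    proof eventually_elim
      case (elim x)
      have "reflector_density (P i) (w i) x * F x \<le> 1 / r\<^sup>2 * F x" if "x \<in> visible w i"
      proof (intro mult_right_mono reflector_density_le[OF pos])
        have "x \<in> closure \<Omega>" using that visible_subset by blast
        then show "norm x = 1" "r \<le> rad w i x" using norm_closure assms(4) by auto
      qed (use assms(3) elim in auto)
      then show ?case using elim by (auto simp: indicator_def)
    qed
  qed (use integrable_visible[OF assms(1,2)] F_integrable in auto)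
  then show ?thesis by simp
qed

text \<open>Every direction of \<open>closure \<Omega>\<close> is visible for some index, and there
  the density has the lower bound given by the cosine estimate and \<open>R\<close>. The other
  summands are nonnegative.\<close>

lemma sum_mass_ge:
  assumes "\<forall>j\<in>{1..N}. 0 < w j" "c < 1"
    and "\<And>i. i \<in> {1..N} \<Longrightarrow> eccentricity (P i) (w i) \<le> c"
    and "\<And>x. x \<in> closure \<Omega> \<Longrightarrow> refl_radius N P w x \<le> R"
  shows "(1 - c) / (1 + c) / R\<^sup>2 * integral\<^sup>L surface_measure F \<le> (\<Sum>i=1..N. mass w i)"
proof -
  let ?h = "\<lambda>i x. indicator (visible w i) x * reflector_density (P i) (w i) x * F x"
  have "(1 - c) / (1 + c) / R\<^sup>2 * integral\<^sup>L surface_measure F =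
    (LINT x|surface_measure. (1 - c) / (1 + c) / R\<^sup>2 * F x)"
    by simp
  also have "\<dots> \<le> (LINT x|surface_measure. (\<Sum>i=1..N. ?h i x))"
  proof (rule integral_mono_AE)
    show "AE x in surface_measure. (1 - c) / (1 + c) / R\<^sup>2 * F x \<le> (\<Sum>i=1..N. ?h i x)"
      using F_nonneg
    proof eventually_elim
      case (elim x)
      show ?case
      proof (cases "x \<in> closure \<Omega>")
        case False
        then show ?thesis by (simp add: F_outside)
      next
        case True
        then have x: "norm x = 1" by (rule norm_closure)
        have nonneg: "0 \<le> ?h i x" if "i \<in> {1..N}" for i
          using that assms P_nonzero x elim by (intro mult_nonneg_nonneg reflector_density_nonneg) auto
        obtain i where i: "i \<in> {1..N}" "refl_radius N P w x = rad w i x"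
          by (rule refl_radius_attained)
        then have "x \<in> visible w i" using True by (intro visibleI_refl_radius) auto
        moreover have "(1 - c) / (1 + c) / R\<^sup>2 * F x \<le> reflector_density (P i) (w i) x * F x"
          using i assms P_nonzero x elim assms(4)[OF True]
          by (intro mult_right_mono reflector_density_ge) auto
        ultimately have "(1 - c) / (1 + c) / R\<^sup>2 * F x \<le> ?h i x" by simp
        also have "\<dots> \<le> (\<Sum>i=1..N. ?h i x)"
          using i nonneg by (intro member_le_sum) auto
        finally show ?thesis .
      qed
    qed
  qed (use integrable_visible[OF assms(1)] F_integrable in auto)
  also have "\<dots> = (\<Sum>i=1..N. mass w i)"
    using assms(1) integrable_visible by (subst Bochner_Integration.integral_sum) (auto simp: mass_eq)
  finally show ?thesis .
qed

section \<open>Continuity of the masses in the parameters\<close>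

lemma visible_strict_minimizer:
  assumes "x \<in> closure \<Omega>" "i \<in> {1..N}" "k \<in> {1..N}"
    and "\<forall>j\<in>{1..N} - {k}. rad w k x < rad w j x"
  shows "x \<in> visible w i \<longleftrightarrow> i = k"
proof
  assume "x \<in> visible w i"
  then have "rad w i x \<le> rad w k x" using assms(3) by (simp add: visible_def)
  then show "i = k" using assms(2) assms(4)[rule_format, of i] by (cases "i = k") auto
next
  assume "i = k"
  have "rad w k x \<le> rad w j x" if "j \<in> {1..N}" for j
    using assms(4) that by (cases "j = k") (auto simp: less_imp_le)
  then show "x \<in> visible w i"
    using assms(1) \<open>i = k\<close> by (simp add: visible_def)
qed

text \<open>Dominated convergence. Away from ties of the limit the strict minimiser keeps its index
  for large \<open>n\<close>, so the indicators are eventually constant; the common lower bound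
  \<open>a\<close> provides the majorant.\<close>

lemma mass_tendsto:
  assumes "0 < a" "i \<in> {1..N}" "\<And>n. \<forall>j\<in>{1..N}. a \<le> u n j"
    and lim: "\<And>j. j \<in> {1..N} \<Longrightarrow> (\<lambda>n. u n j) \<longlonglongrightarrow> w j"
  shows "(\<lambda>n. mass (u n) i) \<longlonglongrightarrow> mass w i"
proof -
  have upos: "\<forall>j\<in>{1..N}. 0 < u n j" for n using assms(1) assms(3)[of n] by force
  have wa: "\<forall>j\<in>{1..N}. a \<le> w j"
  proof
    fix j assume j: "j \<in> {1..N}"
    then show "a \<le> w j" using assms(3) by (intro LIMSEQ_le_const[OF lim[OF j]]) auto
  qed
  then have wpos: "\<forall>j\<in>{1..N}. 0 < w j" using assms(1) less_le_trans by blast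
  let ?h = "\<lambda>w x. indicator (visible w i) x * reflector_density (P i) (w i) x * F x"
  have "(\<lambda>n. LINT x|surface_measure. ?h (u n) x) \<longlonglongrightarrow> (LINT x|surface_measure. ?h w x)"
  proof (rule integral_dominated_convergence)
    \<comment> \<open>All radii are at least \<open>a / 2\<close>, since a parameter is divided by
      at most \<open>1 + 1\<close>.\<close>
    show "integrable surface_measure (\<lambda>x. 1 / (a / 2)\<^sup>2 * F x)" using F_integrable by simp
    show "AE x in surface_measure. norm (?h (u n) x) \<le> 1 / (a / 2)\<^sup>2 * F x" for n
      using F_nonneg
    proof eventually_elim
      case (elim x)
      have "\<bar>reflector_density (P i) (u n i) x\<bar> \<le> 1 / (a / 2)\<^sup>2" if "x \<in> visible (u n) i"
      proof -
        have x: "norm x = 1" using that visible_subset norm_closure by blast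
        have pos: "P i \<noteq> 0" "0 < u n i" using upos assms(2) P_nonzero by auto
        note e = eccentricity_bounds[OF pos]
        have "a / 2 \<le> u n i / (1 + eccentricity (P i) (u n i))"
          using e pos assms(1,2) assms(3)[of n] by (intro frac_le) auto
        also have "\<dots> \<le> polar_radius (P i) (u n i) x"
          by (rule polar_radius_bounds(1)[OF pos x order_refl e(2)])
        finally show ?thesis
          using reflector_density_le[OF pos x, of "a / 2"] reflector_density_nonneg[OF pos x] assms(1) by simp
      qed
      then have "\<bar>reflector_density (P i) (u n i) x\<bar> * \<bar>F x\<bar> \<le> 1 / (a / 2)\<^sup>2 * F x" if "x \<in> visible (u n) i"
        using that elim by (intro mult_mono) auto
      then show ?case using elim by (auto simp: indicator_def abs_mult)
    qed
    show "AE x in surface_measure. (\<lambda>n. ?h (u n) x) \<longlonglongrightarrow> ?h w x"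
      using AE_no_ties[OF wpos]
    proof eventually_elim
      case (elim x)
      show ?case
      proof (cases "x \<in> closure \<Omega>")
        case False
        then show ?thesis by (simp add: F_outside)
      next
        case True
        have rad_lim: "(\<lambda>n. rad (u n) j x) \<longlonglongrightarrow> rad w j x" if "j \<in> {1..N}" for j
          using that wpos P_nonzero norm_closure[OF True] lim by (intro tendsto_polar_radius) auto
        obtain k where k: "k \<in> {1..N}" "refl_radius N P w x = rad w k x"
          by (rule refl_radius_attained)
        then have xk: "x \<in> visible w k" using True by (intro visibleI_refl_radius) auto
        have less: "rad w k x < rad w j x" if "j \<in> {1..N} - {k}" for j
        proof -
          have "rad w k x \<le> rad w j x" using xk that by (simp add: visible_def)
          moreover have "rad w k x \<noteq> rad w j x" using elim True k(1) that by auto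
          ultimately show ?thesis by simp
        qed
        have "\<forall>\<^sub>F n in sequentially. \<forall>j\<in>{1..N} - {k}. rad (u n) k x < rad (u n) j x"
        proof (rule eventually_ball_finite)
          show "\<forall>j\<in>{1..N} - {k}. \<forall>\<^sub>F n in sequentially. rad (u n) k x < rad (u n) j x"
          proof
            fix j assume j: "j \<in> {1..N} - {k}"
            have "(\<lambda>n. rad (u n) j x - rad (u n) k x) \<longlonglongrightarrow> rad w j x - rad w k x"
              using j k(1) by (intro tendsto_diff rad_lim) auto
            then have "\<forall>\<^sub>F n in sequentially. 0 < rad (u n) j x - rad (u n) k x"
              using less[OF j] by (intro order_tendstoD(1)) auto
            then show "\<forall>\<^sub>F n in sequentially. rad (u n) k x < rad (u n) j x"
              by eventually_elim simp
          qed
        qed simp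
        then have "\<forall>\<^sub>F n in sequentially. indicator (visible w i) x * reflector_density (P i) (u n i) x * F x
          = ?h (u n) x"
        proof eventually_elim
          case (elim n)
          have "x \<in> visible (u n) i \<longleftrightarrow> i = k"
            using True assms(2) k(1) elim by (rule visible_strict_minimizer)
          moreover have "x \<in> visible w i \<longleftrightarrow> i = k"
            using True assms(2) k(1) less by (intro visible_strict_minimizer) auto
          ultimately show ?case by (simp add: indicator_def)
        qed
        moreover have "(\<lambda>n. indicator (visible w i) x * reflector_density (P i) (u n i) x * F x) \<longlonglongrightarrow>
            ?h w x"
          using assms(2) wpos P_nonzero norm_closure[OF True] lim
          by (intro tendsto_intros tendsto_reflector_density) auto
        ultimately show ?thesis using Lim_transform_eventually by fastforce
      qed
    qed
  qed (use integrable_visible wpos upos assms(2) in \<open>blast intro: borel_measurable_integrable\<close>)+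
  then show ?thesis by (simp add: mass_eq[OF wpos assms(2)] mass_eq[OF upos assms(2)])
qed

text \<open>The product topology on \<open>nat \<Rightarrow> real\<close> is first countable, so
  sequences suffice, and their convergence implies that of each coordinate.\<close>

lemma continuous_on_mass:
  assumes "0 < a" "i \<in> {1..N}"
  shows "continuous_on ({1..N} \<rightarrow>\<^sub>E {a..b}) (\<lambda>w. mass w i)"
proof (rule continuous_on_sequentiallyI)
  fix u w
  assume u: "\<forall>n. u n \<in> {1..N} \<rightarrow>\<^sub>E {a..b}" and lim: "u \<longlonglongrightarrow> w"
  have "isCont (\<lambda>v::nat \<Rightarrow> real. v j) w" for j
    by (rule continuous_on_interior[OF continuous_on_product_coordinates]) simp
  then have "(\<lambda>n. u n j) \<longlonglongrightarrow> w j" for j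
    using lim by (rule isCont_tendsto_compose)
  moreover have "\<forall>j\<in>{1..N}. a \<le> u n j" for n
    using PiE_mem[OF u[rule_format, of n]] by simp
  ultimately show "(\<lambda>n. mass (u n) i) \<longlonglongrightarrow> mass w i"
    by (intro mass_tendsto[OF assms]) auto
qed

end

subsection \<open>Existence of minimal solutions\<close>

text \<open>Tychonoff's theorem: a box of extensional functions is a full product whose factors
  outside \<open>I\<close> are the singleton of \<open>undefined\<close>.\<close>

lemma compact_PiE_interval:
  fixes a b :: real
  assumes "finite I"
  shows "compact (I \<rightarrow>\<^sub>E {a..b})"
proof -
  have "I \<rightarrow>\<^sub>E {a..b} = (\<Pi>\<^sub>E i\<in>UNIV. if i \<in> I then {a..b} else {undefined})"
    by (auto simp: PiE_def Pi_def extensional_def split: if_splits)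
  moreover have "compactin (product_topology (\<lambda>i. euclidean) UNIV)
    (\<Pi>\<^sub>E i\<in>UNIV. if i \<in> I then {a..b} else {undefined})"
    unfolding compactin_PiE by auto
  ultimately show ?thesis by (simp add: euclidean_product_topology)
qed

lemma PiE_atLeastAtMostI:
  fixes w :: "'a \<Rightarrow> 'b::preorder"
  assumes "w \<in> I \<rightarrow>\<^sub>E {a..}" "\<And>i. i \<in> I \<Longrightarrow> w i \<le> b"
  shows "w \<in> I \<rightarrow>\<^sub>E {a..b}"
  using assms by (auto simp: PiE_iff)

lemma PiE_atLeastAtMostD:
  fixes w :: "'a \<Rightarrow> 'b::preorder"
  assumes "w \<in> I \<rightarrow>\<^sub>E {a..b}"
  shows "w \<in> I \<rightarrow>\<^sub>E {a..}"
  using assms by (auto simp: PiE_iff)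

text \<open>In the application \<open>a\<close> is \<open>\<delta> * M\<close>, and \<open>c\<close>
  is the eccentricity for \<open>d / norm P = \<delta>\<close>.\<close>

locale bounded_reflector = reflector +
  fixes a c :: real
  assumes a_pos: "0 < a" and c_pos: "0 < c" and c_less: "c < 1"
    and ecc_le: "\<And>i d. i \<in> {1..N} \<Longrightarrow> a \<le> d \<Longrightarrow> eccentricity (P i) d \<le> c"
begin

section \<open>Estimates uniform in the parameters above \<open>a\<close>\<close>

lemma rad_bounds:
  assumes "i \<in> {1..N}" "a \<le> w i" "x \<in> closure \<Omega>"
  shows "w i / (1 + c) \<le> rad w i x" "rad w i x \<le> w i / (1 - c)"
proof -
  have "0 < w i" using assms(2) a_pos by simp
  then show "w i / (1 + c) \<le> rad w i x" "rad w i x \<le> w i / (1 - c)"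
    using polar_radius_bounds[OF P_nonzero[OF assms(1)] _ norm_closure[OF assms(3)]
      ecc_le[OF assms(1,2)] c_less] by auto
qed

lemma pos_of_ge: "\<forall>j\<in>{1..N}. a \<le> w j \<Longrightarrow> \<forall>j\<in>{1..N}. 0 < w j"
  using a_pos less_le_trans by blast

text \<open>Positive mass yields a direction in which the \<open>i\<close>-th radius is minimal.
  Comparing the radii there compares the parameters, at the cost of the factors \<open>1 + c\<close>
  and \<open>1 - c\<close>.\<close>

lemma ratio_le:
  assumes "\<forall>j\<in>{1..N}. a \<le> w j" "i \<in> {1..N}" "j \<in> {1..N}" "0 < mass w i"
  shows "w i \<le> (1 + c) / (1 - c) * w j"
proof -
  obtain x where x: "x \<in> visible w i"
    using visible_nonempty[OF pos_of_ge[OF assms(1)] assms(2,4)] .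
  then have xc: "x \<in> closure \<Omega>" by (simp add: visible_def)
  have "w i / (1 + c) \<le> rad w i x" using rad_bounds(1) assms(1,2) xc by auto
  also have "\<dots> \<le> rad w j x" using x assms(3) by (simp add: visible_def)
  also have "\<dots> \<le> w j / (1 - c)" using rad_bounds(2) assms(1,3) xc by auto
  finally show ?thesis using c_pos c_less by (simp add: field_simps)
qed

text \<open>Read backwards, a lower bound on a mass bounds its parameter from above, which replaces
  fixing \<open>w 1\<close>.\<close>

lemma mass_upper:
  assumes "\<forall>j\<in>{1..N}. a \<le> w j" "i \<in> {1..N}"
  shows "mass w i \<le> (1 + c)\<^sup>2 * integral\<^sup>L surface_measure F / (w i)\<^sup>2"
proof -
  have "0 < w i" using pos_of_ge[OF assms(1)] assms(2) by blast
  then have "mass w i \<le> integral\<^sup>L surface_measure F / (w i / (1 + c))\<^sup>2"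
    using rad_bounds(1) assms c_pos by (intro mass_le pos_of_ge) auto
  then show ?thesis by (simp add: power_divide mult.commute)
qed

text \<open>The reflector lies within radius \<open>w k / (1 - c)\<close>. The cube collects one
  factor from the cosine of the normal and two from the square of this radius; at index 1 with the
  prescribed first parameter the coefficient is the constant \<open>C\<close> of the
  theorem.\<close>

lemma sum_mass_lower:
  assumes "\<forall>j\<in>{1..N}. a \<le> w j" "k \<in> {1..N}"
  shows "(1 - c) ^ 3 / ((1 + c) * (w k)\<^sup>2) * integral\<^sup>L surface_measure F \<le> (\<Sum>i=1..N. mass w i)"
proof -
  have "(1 - c) / (1 + c) / (w k / (1 - c))\<^sup>2 * integral\<^sup>L surface_measure F \<le> (\<Sum>i=1..N. mass w i)"
  proof (rule sum_mass_ge[OF pos_of_ge[OF assms(1)] c_less])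
    show "refl_radius N P w x \<le> w k / (1 - c)" if "x \<in> closure \<Omega>" for x
    proof -
      have "refl_radius N P w x \<le> rad w k x"
        unfolding refl_radius_def using assms(2) by (intro Min_le) auto
      then show ?thesis using rad_bounds(2)[of k w x] assms that by auto
    qed
  qed (use ecc_le assms(1) in blast)
  moreover have "(1 - c) / (1 + c) / (w k / (1 - c))\<^sup>2 = (1 - c) ^ 3 / ((1 + c) * (w k)\<^sup>2)"
    using c_less by (simp add: power_divide power3_eq_cube power2_eq_square)
  ultimately show ?thesis by (simp only:)
qed

text \<open>The counterpart of \<open>ratio_le\<close>: from the critical ratio on, the
  \<open>i\<close>-th ellipsoid is nowhere inside the \<open>j\<close>-th one over
  \<open>closure \<Omega>\<close>.\<close>

lemma mass_eq_0:
  assumes "\<forall>j\<in>{1..N}. a \<le> w j" "i \<in> {1..N}" "j \<in> {1..N}" "i \<noteq> j"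
    and "(1 + c) / (1 - c) * w j \<le> w i"
  shows "mass w i = 0"
proof (rule mass_dominated[OF pos_of_ge[OF assms(1)] assms(2-4)])
  fix x assume x: "x \<in> closure \<Omega>"
  have "rad w j x \<le> w j / (1 - c)" using rad_bounds(2) assms(1,3) x by auto
  also have "\<dots> \<le> w i / (1 + c)" using assms(5) c_pos c_less by (simp add: field_simps)
  also have "\<dots> \<le> rad w i x" using rad_bounds(1) assms(1,2) x by auto
  finally show "rad w j x \<le> rad w i x" .
qed

section \<open>Parameters with prescribed masses\<close>

lemma closed_box: "closed ({1..N} \<rightarrow>\<^sub>E {a..b})"
  by (intro compact_imp_closed compact_PiE_interval) simp

lemma compact_subset_box:
  assumes "closed S" "S \<subseteq> {1..N} \<rightarrow>\<^sub>E {a..b}"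
  shows "compact S"
  using compact_Int_closed[OF compact_PiE_interval[of "{1..N}" a b] assms(1)] assms(2)
  by (simp add: Int_absorb1)

lemma exists_prescribed_masses:
  assumes N2: "1 < N" and g: "\<And>i. i \<in> {1..N} \<Longrightarrow> 0 < g i"
    and b: "(1 + c) / (1 - c) * a \<le> b"
    and total: "(\<Sum>i=1..N. g i) \<le> (1 - c) ^ 3 / ((1 + c) * b\<^sup>2) * integral\<^sup>L surface_measure F"
  shows "\<exists>w \<in> {1..N} \<rightarrow>\<^sub>E {a..}. w 1 = b \<and> (\<forall>i\<in>{2..N}. mass w i = g i)"
proof -
  define q where "q = (1 + c) / (1 - c)"
  have q: "1 < q" using c_pos c_less by (simp add: q_def)
  \<comment> \<open>The critical ratio times the first parameter: an ellipsoid with parameter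
    \<open>L\<close> carries no mass beside the first one. This makes the box large enough to
    contain the feasible point \<open>w0\<close>.\<close>
  define L where "L = q * b"
  have "a \<le> q * a" using q a_pos by simp
  then have ab: "a \<le> b" using b by (simp add: q_def)
  then have bL: "b \<le> L" using q a_pos by (simp add: L_def)
  define box where "box = ({1..N} \<rightarrow>\<^sub>E {a..L})"
  define K where "K = {w \<in> box. w 1 = b \<and> (\<forall>i\<in>{2..N}. mass w i \<le> g i)}"
  have box: "closed box" unfolding box_def by (rule closed_box)
  have coord: "continuous_on box (\<lambda>w. w i)" for i
    by (rule continuous_on_subset[OF continuous_on_product_coordinates]) simp
  have "closed {w \<in> box. mass w i \<le> g i}" if "i \<in> {2..N}" for i
    using that box a_pos unfolding box_def
    by (intro continuous_on_closed_Collect_le continuous_on_mass continuous_on_const) auto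
  moreover have "closed {w \<in> box. w 1 = b}"
    using coord box by (rule continuous_closed_preimage_constant)
  moreover have "K = {w \<in> box. w 1 = b} \<inter> (\<Inter>i\<in>{2..N}. {w \<in> box. mass w i \<le> g i})"
    using N2 by (auto simp: K_def)
  ultimately have "closed K" by (simp add: closed_Int closed_INT)
  then have K: "compact K"
    by (rule compact_subset_box) (auto simp: K_def box_def)
  define w0 where "w0 = (\<lambda>i\<in>{1..N}. if i = 1 then b else L)"
  have w0: "\<forall>j\<in>{1..N}. a \<le> w0 j" using ab bL by (auto simp: w0_def)
  have "mass w0 i = 0" if "i \<in> {2..N}" for i
    using that N2 by (intro mass_eq_0[OF w0, of i 1]) (auto simp: w0_def L_def q_def)
  then have "w0 \<in> K"
    using ab bL N2 g by (auto simp: K_def box_def w0_def less_imp_le)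
  then have "K \<noteq> {}" by blast
  moreover have "continuous_on K (\<lambda>w. \<Sum>i=1..N. w i)"
    by (intro continuous_on_sum continuous_on_subset[OF coord]) (auto simp: K_def)
  ultimately obtain w where w: "w \<in> K" and min: "\<And>v. v \<in> K \<Longrightarrow> (\<Sum>i=1..N. w i) \<le> (\<Sum>i=1..N. v i)"
    using continuous_attains_inf[OF K] by blast
  have wE: "w \<in> {1..N} \<rightarrow>\<^sub>E {a..L}" and w1: "w 1 = b" and wg: "\<And>i. i \<in> {2..N} \<Longrightarrow> mass w i \<le> g i"
    using w by (auto simp: K_def box_def)
  have wa: "\<forall>j\<in>{1..N}. a \<le> w j" using PiE_mem[OF wE] by simp
  have one: "1 \<in> {1..N}" using N2 by simp
  have split: "(\<Sum>i=1..N. h i) = h 1 + (\<Sum>i=2..N. h i)" for h :: "nat \<Rightarrow> real"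
    using N2 by (simp add: sum.atLeast_Suc_atMost numeral_2_eq_2)
  have "mass w i = g i" if i: "i \<in> {2..N}" for i
  proof (rule ccontr)
    assume "mass w i \<noteq> g i"
    then have less: "mass w i < g i" using wg[OF i] by simp
    have i1: "i \<in> {1..N}" "i \<noteq> 1" using i by auto
    \<comment> \<open>At \<open>w i = a\<close> the first parameter \<open>b\<close> has reached the
      critical ratio, so the first mass vanishes. The remaining masses then total less than the sum
      of all \<open>g\<close>, against the lower bound on the total mass.\<close>
    have "w i \<noteq> a"
    proof
      assume "w i = a"
      then have "mass w 1 = 0"
        using b w1 i1 by (intro mass_eq_0[OF wa one i1(1)]) auto
      then have "(\<Sum>i=1..N. mass w i) = (\<Sum>i=2..N. mass w i)"
        using split[of "mass w"] by simp
      also have "\<dots> \<le> (\<Sum>i=2..N. g i)" by (intro sum_mono wg)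
      also have "\<dots> < (\<Sum>i=1..N. g i)" using g[OF one] split[of g] by simp
      also have "\<dots> \<le> (\<Sum>i=1..N. mass w i)"
        using total sum_mass_lower[OF wa one] w1 by simp
      finally show False by simp
    qed
    then have wi: "a < w i" using wa i1 by force
    \<comment> \<open>Only the \<open>i\<close>-th parameter is lowered, and never below
      \<open>a\<close>, the value at \<open>n = 0\<close>. Close to \<open>w\<close> the
      \<open>i\<close>-th constraint persists by continuity and the others by monotonicity, while
      the sum drops.\<close>
    define u where "u n = w(i := w i - (w i - a) / real (Suc n))" for n
    have ui: "a \<le> u n i" "u n i < w i" for n
    proof -
      have "(w i - a) / real (Suc n) \<le> (w i - a) / 1"
        using wi by (intro divide_left_mono) auto
      then show "a \<le> u n i" by (simp add: u_def)
      show "u n i < w i" using wi by (simp add: u_def)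
    qed
    have ua: "\<forall>j\<in>{1..N}. a \<le> u n j" for n
      using ui(1)[of n] wa by (auto simp: u_def)
    have "(\<lambda>n. w i - (w i - a) * inverse (real (Suc n))) \<longlonglongrightarrow> w i - (w i - a) * 0"
      by (intro tendsto_intros LIMSEQ_inverse_real_of_nat)
    then have "(\<lambda>n. u n j) \<longlonglongrightarrow> w j" for j
      by (cases "j = i") (simp_all add: u_def divide_inverse)
    then have "(\<lambda>n. mass (u n) i) \<longlonglongrightarrow> mass w i"
      using ua by (intro mass_tendsto[OF a_pos i1(1)]) auto
    then have "\<forall>\<^sub>F n in sequentially. mass (u n) i < g i"
      using less by (rule order_tendstoD)
    then obtain n where n: "mass (u n) i < g i"
      using eventually_happens'[OF sequentially_bot] by blast
    have "mass (u n) j \<le> g j" if j: "j \<in> {2..N}" for j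
    proof (cases "j = i")
      case False
      then have "mass (u n) j \<le> mass w j"
        using ui[of n] a_pos j i1 unfolding u_def
        by (intro mass_update_le[OF pos_of_ge[OF wa]]) auto
      then show ?thesis using wg[OF j] by simp
    qed (use n in simp)
    moreover have "u n \<in> box"
      unfolding box_def
    proof (rule PiE_I)
      fix j assume j: "j \<in> {1..N}"
      have "u n j \<le> w j" using ui(2)[of n] by (cases "j = i") (auto simp: u_def)
      also have "\<dots> \<le> L" using PiE_mem[OF wE j] by simp
      finally show "u n j \<in> {a..L}" using ua[of n] j by simp
    next
      fix j assume "j \<notin> {1..N}"
      then show "u n j = undefined" using i1 PiE_arb[OF wE] by (auto simp: u_def)
    qed
    moreover have "u n 1 = b" using w1 i1 by (simp add: u_def)
    ultimately have "u n \<in> K" by (simp add: K_def)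
    then have "(\<Sum>i=1..N. w i) \<le> (\<Sum>i=1..N. u n i)" by (rule min)
    moreover have "(\<Sum>i=1..N. u n i) < (\<Sum>i=1..N. w i)"
    proof (rule sum_strict_mono_ex1)
      show "\<forall>j\<in>{1..N}. u n j \<le> w j" using ui(2)[of n] by (auto simp: u_def)
      show "\<exists>j\<in>{1..N}. u n j < w j" using ui(2)[of n] i1 by blast
    qed simp
    ultimately show False by simp
  qed
  moreover have "w \<in> {1..N} \<rightarrow>\<^sub>E {a..}" using wE by (auto simp: PiE_iff)
  ultimately show ?thesis using w1 by blast
qed

section \<open>Minimisers of the first mass\<close>

lemma closed_prescribed:
  "closed {w \<in> {1..N} \<rightarrow>\<^sub>E {a..b}. \<forall>i\<in>{2..N}. mass w i = g i}"
proof -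
  have "{w \<in> {1..N} \<rightarrow>\<^sub>E {a..b}. \<forall>i\<in>{2..N}. mass w i = g i} =
    ({1..N} \<rightarrow>\<^sub>E {a..b}) \<inter> (\<Inter>i\<in>{2..N}. {w \<in> {1..N} \<rightarrow>\<^sub>E {a..b}. mass w i = g i})"
    by auto
  moreover have "closed {w \<in> {1..N} \<rightarrow>\<^sub>E {a..b}. mass w i = g i}" if "i \<in> {2..N}" for i
    using that by (intro continuous_closed_preimage_constant continuous_on_mass a_pos closed_box) auto
  ultimately show ?thesis
    by (simp only:) (intro closed_Int closed_INT closed_box ballI)
qed

lemma attains_min_mass:
  assumes "S \<noteq> {}" "closed S" "S \<subseteq> {1..N} \<rightarrow>\<^sub>E {a..b}"
  shows "\<exists>v\<in>S. \<forall>w\<in>S. mass v 1 \<le> mass w 1"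
  using N by (intro continuous_attains_inf compact_subset_box[OF assms(2,3)] assms(1)
    continuous_on_subset[OF continuous_on_mass[OF a_pos] assms(3)]) auto

text \<open>The masses from index 2 on are positive, so \<open>ratio_le\<close> bounds their
  parameters by a multiple of the fixed first one. The set is then a closed part of a compact
  box.\<close>

lemma minimal_on_fixed_first:
  assumes "\<And>i. i \<in> {1..N} \<Longrightarrow> 0 < g i"
    and "{w \<in> {1..N} \<rightarrow>\<^sub>E {a..}. w 1 = b \<and> (\<forall>i\<in>{2..N}. mass w i = g i)} \<noteq> {}" (is "?S \<noteq> {}")
  shows "\<exists>v\<in>?S. \<forall>w\<in>?S. mass v 1 \<le> mass w 1"
proof -
  define L where "L = (1 + c) / (1 - c) * b"
  have one: "1 \<in> {1..N}" using N by simp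
  have "w i \<le> max b L" if "w \<in> ?S" "i \<in> {1..N}" for w i
  proof (cases "i = 1")
    case False
    then have i: "i \<in> {2..N}" using that(2) by auto
    have "\<forall>j\<in>{1..N}. a \<le> w j" using that(1) by (auto simp: PiE_iff)
    moreover have "0 < mass w i" using that assms(1) i by auto
    ultimately have "w i \<le> (1 + c) / (1 - c) * w 1" using that(2) one by (intro ratio_le)
    then show ?thesis using that(1) by (simp add: L_def)
  qed (use that in auto)
  then have mem: "w \<in> {1..N} \<rightarrow>\<^sub>E {a..max b L}" if "w \<in> ?S" for w
    using that by (intro PiE_atLeastAtMostI) blast+
  have "?S = {w \<in> {1..N} \<rightarrow>\<^sub>E {a..max b L}. w 1 = b} \<inter>
      {w \<in> {1..N} \<rightarrow>\<^sub>E {a..max b L}. \<forall>i\<in>{2..N}. mass w i = g i}"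
    using mem PiE_atLeastAtMostD by blast
  moreover have "closed {w \<in> {1..N} \<rightarrow>\<^sub>E {a..max b L}. w 1 = b}"
    by (intro continuous_closed_preimage_constant closed_box
      continuous_on_subset[OF continuous_on_product_coordinates]) simp
  ultimately show ?thesis
    using assms(2) closed_prescribed
    by (intro attains_min_mass[of _ "max b L"]) auto
qed

text \<open>The first parameter is not fixed here, but \<open>g 1 \<le> mass w 1\<close> bounds it
  through \<open>mass_upper\<close>; \<open>ratio_le\<close> then bounds the others.\<close>

lemma minimal_on_free_first:
  assumes "\<And>i. i \<in> {1..N} \<Longrightarrow> 0 < g i"
    and "{w \<in> {1..N} \<rightarrow>\<^sub>E {a..}. g 1 \<le> mass w 1 \<and> (\<forall>i\<in>{2..N}. mass w i = g i)} \<noteq> {}" (is "?S \<noteq> {}")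
  shows "\<exists>v\<in>?S. \<forall>w\<in>?S. mass v 1 \<le> mass w 1"
proof -
  \<comment> \<open>The value of \<open>w 1\<close> at which the bound of \<open>mass_upper\<close>
    equals \<open>g 1\<close>.\<close>
  define R where "R = (1 + c) * sqrt (integral\<^sup>L surface_measure F / g 1)"
  define L where "L = (1 + c) / (1 - c) * R"
  have one: "1 \<in> {1..N}" using N by simp
  have bound: "w i \<le> L" if w: "w \<in> ?S" and i: "i \<in> {1..N}" for w i
  proof -
    have wa: "\<forall>j\<in>{1..N}. a \<le> w j" using w by (auto simp: PiE_iff)
    have w1: "0 < w 1" using pos_of_ge[OF wa] one by blast
    have "g 1 \<le> (1 + c)\<^sup>2 * integral\<^sup>L surface_measure F / (w 1)\<^sup>2"
      using mass_upper[OF wa one] w by simp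
    then have "(w 1)\<^sup>2 \<le> (1 + c)\<^sup>2 * (integral\<^sup>L surface_measure F / g 1)"
      using w1 assms(1)[OF one] by (simp add: field_simps)
    also have "\<dots> = R\<^sup>2"
      using integral_F_nonneg assms(1)[OF one] by (simp add: R_def power_mult_distrib)
    finally have "w 1 \<le> R"
      using integral_F_nonneg assms(1)[OF one] c_pos
      by (elim power2_le_imp_le) (simp add: R_def)
    have "0 < mass w i"
    proof (cases "i = 1")
      case True
      then show ?thesis using w assms(1)[OF one] by auto
    next
      case False
      then show ?thesis using w i assms(1)[OF i] by auto
    qed
    then have "w i \<le> (1 + c) / (1 - c) * w 1" using wa i one by (intro ratio_le)
    also have "\<dots> \<le> L"
      unfolding L_def using \<open>w 1 \<le> R\<close> c_pos c_less by (intro mult_left_mono) auto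
    finally show ?thesis .
  qed
  then have mem: "w \<in> {1..N} \<rightarrow>\<^sub>E {a..L}" if "w \<in> ?S" for w
    using that by (intro PiE_atLeastAtMostI) blast+
  have "?S = {w \<in> {1..N} \<rightarrow>\<^sub>E {a..L}. g 1 \<le> mass w 1} \<inter>
      {w \<in> {1..N} \<rightarrow>\<^sub>E {a..L}. \<forall>i\<in>{2..N}. mass w i = g i}"
    using mem PiE_atLeastAtMostD by blast
  moreover have "closed {w \<in> {1..N} \<rightarrow>\<^sub>E {a..L}. g 1 \<le> mass w 1}"
    using one by (intro continuous_on_closed_Collect_le closed_box continuous_on_mass a_pos continuous_on_const)
  ultimately show ?thesis
    using assms(2) closed_prescribed by (intro attains_min_mass[of _ L]) auto
qed

end

theorem proposition4p9:
  fixes \<Omega> D :: "(real^3) set" and f :: "real^3 \<Rightarrow> real"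
    and N :: nat and P :: "nat \<Rightarrow> real^3" and g :: "nat \<Rightarrow> real"
    and M \<delta> c k C :: real and \<C> \<D> :: "(nat \<Rightarrow> real) set"
  assumes "\<Omega> \<subseteq> S2"
    and "(top_of_set S2) frontier_of \<Omega> \<in> null_sets surface_measure"
    and "set_integrable surface_measure (closure \<Omega>) f"
    and "AE x in surface_measure. x \<in> closure \<Omega> \<longrightarrow> f x > 0"
    and "N > 1"
    and "\<And>i. i \<in> {1..N} \<Longrightarrow> g i > 0"
    and "inj_on P {1..N}"
    and "D = P ` {1..N}"
    and "0 \<notin> D"
    and "M = Max ((\<lambda>i. norm (P i)) ` {1..N})"
    and "\<delta> > 0"
    and "c = - \<delta> + sqrt (1 + \<delta>\<^sup>2)"
    and "k \<ge> (1 + c) / (1 - c)"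
    and "C = (1 - c)^3 / ((1 + c) * (k * \<delta> * M)\<^sup>2)"
    and "set_lebesgue_integral surface_measure (closure \<Omega>) f \<ge> 1 / C * target_measure N P g D"
    and "\<C> = {w \<in> {1..N} \<rightarrow>\<^sub>E {0<..}. w 1 = k * \<delta> * M \<and> (\<forall>i\<in>{1..N}. w i \<ge> \<delta> * M) \<and>
               (\<forall>i\<in>{2..N}. reflector_measure \<Omega> f N P w {P i} = g i)}"
    and "\<D> = {w \<in> {1..N} \<rightarrow>\<^sub>E {0<..}. (\<forall>i\<in>{1..N}. w i \<ge> \<delta> * M) \<and>
               reflector_measure \<Omega> f N P w {P 1} \<ge> g 1 \<and>
               (\<forall>i\<in>{2..N}. reflector_measure \<Omega> f N P w {P i} = g i)}"
  shows "(\<exists>w\<^sub>C\<in>\<C>. \<forall>w\<in>\<C>. reflector_measure \<Omega> f N P w\<^sub>C {P 1} \<le> reflector_measure \<Omega> f N P w {P 1}) \<and>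
         (\<exists>w\<^sub>D\<in>\<D>. \<forall>w\<in>\<D>. reflector_measure \<Omega> f N P w\<^sub>D {P 1} \<le> reflector_measure \<Omega> f N P w {P 1})"
proof -
  note g_pos = assms(6)
  have sum_eq: "target_measure N P g D = (\<Sum>i=1..N. g i)"
    using assms(8) by (simp add: target_measure_def)
  have P0: "P i \<noteq> 0" if "i \<in> {1..N}" for i
    using that assms(8,9) by auto
  have P_le: "norm (P i) \<le> M" if "i \<in> {1..N}" for i
    unfolding assms(10) using that by (intro Max_ge) auto
  have one: "1 \<in> {1..N}" using assms(5) by simp
  have "0 < norm (P 1)" using P0[OF one] by simp
  also have "\<dots> \<le> M" by (rule P_le[OF one])
  finally have M: "0 < M" .
  define a where "a = \<delta> * M"
  have a: "0 < a" using M assms(11) by (simp add: a_def)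
  have c: "0 < c" "c < 1" using sqrt_minus_bounds[OF assms(11)] by (simp_all add: assms(12))
  interpret bounded_reflector \<Omega> f N P a c
  proof
    show "eccentricity (P i) d \<le> c" if i: "i \<in> {1..N}" and d: "a \<le> d" for i d
    proof -
      \<comment> \<open>Since \<open>M\<close> is the largest norm, \<open>d / norm (P i)\<close> is
        at least \<open>\<delta>\<close> for every focus, and \<open>c\<close> is the eccentricity
        at the ratio \<open>\<delta>\<close>.\<close>
      have "\<delta> * norm (P i) \<le> \<delta> * M" using P_le[OF i] assms(11) by simp
      then have "\<delta> \<le> d / norm (P i)" using d P0[OF i] by (simp add: a_def field_simps)
      then show ?thesis
        using sqrt_minus_antimono[of \<delta> "d / norm (P i)"] assms(11,12) by (simp add: eccentricity_alt)
    qed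
  qed (use assms(1-5,7) P0 a c in auto)
  define b where "b = k * \<delta> * M"
  have mass: "reflector_measure \<Omega> f N P w {P i} = mass w i" for w i
    by (simp add: mass_def)
  have PiE: "w \<in> {1..N} \<rightarrow>\<^sub>E {0<..} \<and> (\<forall>i\<in>{1..N}. a \<le> w i) \<longleftrightarrow> w \<in> {1..N} \<rightarrow>\<^sub>E {a..}" for w
    using a less_le_trans[OF a] by (auto simp: PiE_iff)
  have \<C>: "\<C> = {w \<in> {1..N} \<rightarrow>\<^sub>E {a..}. w 1 = b \<and> (\<forall>i\<in>{2..N}. mass w i = g i)}"
    unfolding assms(16) mass a_def[symmetric] b_def[symmetric] using PiE by blast
  have \<D>: "\<D> = {w \<in> {1..N} \<rightarrow>\<^sub>E {a..}. g 1 \<le> mass w 1 \<and> (\<forall>i\<in>{2..N}. mass w i = g i)}"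
    unfolding assms(17) mass a_def[symmetric] using PiE by blast
  have "1 < (1 + c) / (1 - c)" using c by simp
  then have "0 < k" using assms(13) by linarith
  then have "0 < b" using M assms(11) by (simp add: b_def)
  \<comment> \<open>The hypothesis on \<open>k\<close> puts the first parameter at or beyond the
    critical ratio to the least admissible one.\<close>
  have ab: "(1 + c) / (1 - c) * a \<le> b"
    using mult_right_mono[OF assms(13), of a] a by (simp add: a_def b_def mult.assoc)
  have C: "C = (1 - c) ^ 3 / ((1 + c) * b\<^sup>2)" by (simp add: assms(14) b_def)
  have C_pos: "0 < C"
    unfolding C using c \<open>0 < b\<close> by (intro divide_pos_pos mult_pos_pos zero_less_power) auto
  have "(\<Sum>i=1..N. g i) / C \<le> integral\<^sup>L surface_measure F"
    using assms(15) by (simp add: sum_eq set_lebesgue_integral_def F_def[abs_def])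
  then have total: "(\<Sum>i=1..N. g i) \<le> (1 - c) ^ 3 / ((1 + c) * b\<^sup>2) * integral\<^sup>L surface_measure F"
    unfolding C[symmetric] using C_pos by (simp add: divide_le_eq mult.commute)
  obtain w where w: "w \<in> {1..N} \<rightarrow>\<^sub>E {a..}" "w 1 = b" "\<And>i. i \<in> {2..N} \<Longrightarrow> mass w i = g i"
    using exists_prescribed_masses[OF assms(5) g_pos ab total] by blast
  then have "w \<in> \<C>" by (simp add: \<C>)
  \<comment> \<open>The same \<open>w\<close> lies in the second set: its total mass is at least the
    sum of all \<open>g\<close>, and the masses from index 2 on match exactly, leaving at least
    \<open>g 1\<close> for the first.\<close>
  have "\<forall>j\<in>{1..N}. a \<le> w j" using PiE_mem[OF w(1)] by simp
  then have "(\<Sum>i=1..N. g i) \<le> (\<Sum>i=1..N. mass w i)"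
    using sum_mass_lower[OF _ one, of w] total w(2) by simp
  moreover have "(\<Sum>i=1..N. h i) = h 1 + (\<Sum>i=2..N. h i)" for h :: "nat \<Rightarrow> real"
    using assms(5) by (simp add: sum.atLeast_Suc_atMost numeral_2_eq_2)
  moreover have "(\<Sum>i=2..N. mass w i) = (\<Sum>i=2..N. g i)" by (intro sum.cong w(3)) auto
  ultimately have "g 1 \<le> mass w 1" by (metis add_le_cancel_right)
  then have "w \<in> \<D>" using w by (simp add: \<D>)
  show ?thesis
    unfolding mass
  proof
    show "\<exists>v\<in>\<C>. \<forall>w\<in>\<C>. mass v 1 \<le> mass w 1"
      using \<open>w \<in> \<C>\<close> unfolding \<C> by (intro minimal_on_fixed_first g_pos) auto
    show "\<exists>v\<in>\<D>. \<forall>w\<in>\<D>. mass v 1 \<le> mass w 1"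
      using \<open>w \<in> \<D>\<close> unfolding \<D> by (intro minimal_on_free_first g_pos) auto
  qed
qed

end
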